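(* Let $p$ be a prime number and let $n\ge 1$ be the spatial dimension. Suppose that $G$ and $H$ are two 1-D lowpass filters with dilation $p$, and that $H$ is interpolatory. Let $S:=\widehat G$ and $U:=\widehat H$ be the 1-D refinement masks associated with $G$ and $H$, and let $\mathcal{C}_{n,p}$ be the prime coset sum. Define $n$-D biorthogonal refinement masks by $$\tau(\omega):=\mathcal{C}_{n,p}[S](\omega)+\Big(1-\sum_{\gamma\in\Gamma^\ast}\mathcal{C}_{n,p}[S](\omega+\gamma)\,\overline{\mathcal{C}_{n,p}[U](\omega+\gamma)}\Big),\qquad \tau^{\rm d}(\omega):=\mathcal{C}_{n,p}[U](\omega),$$ for every $\omega\in\mathbb{T}^n$, and $n$-D wavelet masks, for $\nu\in\Gamma'$ and every $\omega\in\mathbb{T}^n$, by $$t_\nu(\omega):=e^{-i\omega\cdot\nu}\Big(1-\frac{p}{p-1}\sum_{l\in F_p'}e^{i(\omega\cdot\eta(l,\nu))l}\;\overline{U_l\big(p\,\omega\cdot\eta(l,\nu)\big)}\Big),$$ $$t_\nu^{\rm d}(\omega):=\frac{1}{p^n}e^{-i\omega\cdot\nu}\Big(1-\frac{p}{p-1}\sum_{l\in F_p'}e^{i(\omega\cdot\eta(l,\nu))l}\;\overline{S_l\big(p\,\omega\cdot\eta(l,\nu)\big)}\;\tau^{\rm d}(\omega)\Big),$$ where, for $l\in F_p'$ and $\xi\in\mathbb{T}$, $U_l(\xi):=\frac1p\sum_{m\in\mathbb{Z}}H(l+pm)e^{-im\xi}$ and $S_l(\xi):=\frac1p\sum_{m\in\mathbb{Z}}G(l+pm)e^{-im\xi}$.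 Then $(\tau,(t_\nu)_{\nu\in\Gamma'})$ and $(\tau^{\rm d},(t_\nu^{\rm d})_{\nu\in\Gamma'})$ form $n$-D combined biorthogonal masks (with dilation $p\,\mathtt{I}_n$).
   Context: Write $\mathbb{T}^n=[-\pi,\pi]^n$; masks are $2\pi\mathbb{Z}^n$-periodic functions. Coset representatives. $\Gamma$ is a fixed complete set of representatives, containing $0$, of the distinct cosets of $\mathbb{Z}^n/p\mathbb{Z}^n$ (e.g. $\{0,\dots,p-1\}^n$), and $\Gamma'=\Gamma\setminus\{0\}$. $\Gamma^\ast$ is a complete set of representatives, containing $0$, of the distinct cosets of $2\pi((p^{-1}\mathbb{Z}^n)/\mathbb{Z}^n)$ (e.g. $\frac{2\pi}{p}\{0,\dots,p-1\}^n$). $F_p\subset\mathbb{Z}$ is a complete set of representatives, containing $0$, of the distinct cosets of $\mathbb{Z}/p\mathbb{Z}$, and $F_p'=F_p\setminus\{0\}$. Filters and masks. In dimension $d$ with dilation $p\,\mathtt{I}_d$, a filter is a finitely supported $h:\mathbb{Z}^d\to\mathbb{R}$; its associated mask is the Laurent trigonometric polynomial $\widehat h(\omega)=p^{-d}\sum_{k\in\mathbb{Z}^d}h(k)e^{-ik\cdot\omega}$. The filter $h$ is lowpass, and its mask $\tau$ is a refinement mask, if $\tau(0)=1$, i.e. $\sum_k h(k)=p^d$. A mask $t$ is a wavelet mask if $t(0)=0$. A refinement mask $\tau$ (equivalently its filter) is interpolatory if $\sum_{\gamma}\tau(\omega+\gamma)=1$ for all $\omega$, the sum being over a set of representatives of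 $2\pi((p^{-1}\mathbb{Z}^d)/\mathbb{Z}^d)$; equivalently $h(0)=1$ and $h(k)=0$ for $k\in p\mathbb{Z}^d\setminus\{0\}$. Standing assumption: all refinement masks have accuracy number at least one, i.e. they vanish at every nonzero representative $\gamma$ of $2\pi((p^{-1}\mathbb{Z}^d)/\mathbb{Z}^d)$. Prime coset sum. For a 1-D refinement mask $R$ with dilation $p$, $\mathcal{C}_{n,p}[R]$ is the $n$-D refinement mask with dilation $p\,\mathtt{I}_n$ $$\mathcal{C}_{n,p}[R](\omega):=\frac{1}{(p-1)p^{n-1}}\Big(1-p^{n-1}+\sum_{\nu\in\Gamma'}R(\omega\cdot\nu)\Big),\quad\omega\in\mathbb{T}^n.$$ The map $\eta:F_p'\times\Gamma'\to\Gamma'$. For $l\in F_p'$ let $\rho(l)\in F_p'$ be the unique element with $l\rho(l)\equiv1\pmod p$. For $\nu\in\Gamma'$, $\eta(l,\nu)$ is the unique element of $\Gamma'$ with $\eta(l,\nu)\equiv\rho(l)\nu\pmod{p\mathbb{Z}^n}$. Biorthogonality. Two $n$-D refinement masks $\tau,\tau^{\rm d}$ are biorthogonal if $\sum_{\gamma\in\Gamma^\ast}\overline{\tau(\omega+\gamma)}\,\tau^{\rm d}(\omega+\gamma)=1$ for all $\omega\in\mathbb{T}^n$. For biorthogonal refinement masks $\tau,\tau^{\rm d}$ and wavelet masks $t_\nu,t_\nu^{\rm d}$ ($\nu\in\Gamma'$), the pairs $(\tau,(t_\nu)_{\nu\in\Gamma'})$ and $(\tau^{\rm d},(t_\nu^{\rm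 d})_{\nu\in\Gamma'})$ are called combined biorthogonal masks if for every $\omega\in\mathbb{T}^n$ and every $\gamma\in\Gamma^\ast$ $$\overline{\tau(\omega+\gamma)}\,\tau^{\rm d}(\omega)+\sum_{\nu\in\Gamma'}\overline{t_\nu(\omega+\gamma)}\,t_\nu^{\rm d}(\omega)=\delta_{\gamma,0}.$$ *)

theory Defs
  imports "HOL-Analysis.Analysis" "HOL-Number_Theory.Number_Theory"
begin

text \<open>
  The spatial dimension \<open>n\<close> is \<open>CARD('n)\<close>.  Masks are functions on all of \<open>\<real>\<^sup>n\<close>
  (they are evaluated at points such as \<open>\<omega> + \<gamma>\<close> outside \<open>[-\<pi>,\<pi>]\<^sup>n\<close>); being
  \<open>2\<pi>\<int>\<^sup>n\<close>-periodic, an identity between them on \<open>[-\<pi>,\<pi>]\<^sup>n\<close> is the same as one on \<open>\<real>\<^sup>n\<close>.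
\<close>

definition rvec :: "int ^ 'n \<Rightarrow> real ^ 'n" where
  "rvec k = (\<chi> i. real_of_int (k $ i))"


subsection \<open>Coset representatives\<close>

definition coset_reps :: "'a set \<Rightarrow> 'a set \<Rightarrow> 'a::ab_group_add set \<Rightarrow> bool" where
  "coset_reps L M R \<longleftrightarrow> R \<subseteq> L \<and> 0 \<in> R \<and> (\<forall>x\<in>L. \<exists>!r. r \<in> R \<and> x - r \<in> M)"

definition reps_int :: "nat \<Rightarrow> int set \<Rightarrow> bool" where
  "reps_int p F \<longleftrightarrow> coset_reps UNIV (range (\<lambda>m. int p * m)) F"

definition reps_lattice :: "nat \<Rightarrow> (int ^ 'n) set \<Rightarrow> bool" where
  "reps_lattice p \<Gamma> \<longleftrightarrow> coset_reps UNIV (range (\<lambda>m. int p *s m)) \<Gamma>"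

definition reps_dual :: "nat \<Rightarrow> (real ^ 'n) set \<Rightarrow> bool" where
  "reps_dual p \<Gamma>s \<longleftrightarrow>
     coset_reps (range (\<lambda>k. (2 * pi / real p) *\<^sub>R rvec k)) (range (\<lambda>k. (2 * pi) *\<^sub>R rvec k)) \<Gamma>s"

text \<open>
  In dimension one, conditions on masks that involve representatives of
  \<open>2\<pi>((p\<inverse>\<int>)/\<int>)\<close> do not depend on their choice, and the standard ones are used.
\<close>

definition dual_1d :: "nat \<Rightarrow> real set" where
  "dual_1d p = (\<lambda>j. 2 * pi * real j / real p) ` {..<p}"


subsection \<open>Filters and masks\<close>

definition mask_1d :: "nat \<Rightarrow> (int \<Rightarrow> real) \<Rightarrow> real \<Rightarrow> complex" where
  "mask_1d p h \<xi> =
     1 / of_nat p * (\<Sum>k | h k \<noteq> 0. of_real (h k) * cis (- (real_of_int k * \<xi>)))"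

definition mask_nd :: "nat \<Rightarrow> (int ^ 'n \<Rightarrow> real) \<Rightarrow> real ^ 'n \<Rightarrow> complex" where
  "mask_nd p h \<omega> =
     1 / of_nat p ^ CARD('n) * (\<Sum>k | h k \<noteq> 0. of_real (h k) * cis (- (rvec k \<bullet> \<omega>)))"

definition is_mask :: "nat \<Rightarrow> (real ^ 'n \<Rightarrow> complex) \<Rightarrow> bool" where
  "is_mask p \<tau> \<longleftrightarrow> (\<exists>h. finite {k. h k \<noteq> 0} \<and> \<tau> = mask_nd p h)"

definition lowpass :: "nat \<Rightarrow> (int \<Rightarrow> real) \<Rightarrow> bool" where
  "lowpass p h \<longleftrightarrow> finite {k. h k \<noteq> 0} \<and> mask_1d p h 0 = 1"

text \<open>In the next two definitions \<open>D\<close> is a set of representatives of \<open>2\<pi>((p\<inverse>\<int>\<^sup>d)/\<int>\<^sup>d)\<close>.\<close>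

definition accuracy_ge_one :: "'a::zero set \<Rightarrow> ('a \<Rightarrow> complex) \<Rightarrow> bool" where
  "accuracy_ge_one D \<tau> \<longleftrightarrow> (\<forall>\<gamma>\<in>D - {0}. \<tau> \<gamma> = 0)"

definition interpolatory :: "'a::ab_group_add set \<Rightarrow> ('a \<Rightarrow> complex) \<Rightarrow> bool" where
  "interpolatory D \<tau> \<longleftrightarrow> (\<forall>\<omega>. (\<Sum>\<gamma>\<in>D. \<tau> (\<omega> + \<gamma>)) = 1)"

text \<open>Refinement masks are always understood to have accuracy number at least one.\<close>

definition refinement_mask :: "nat \<Rightarrow> (real ^ 'n) set \<Rightarrow> (real ^ 'n \<Rightarrow> complex) \<Rightarrow> bool" where
  "refinement_mask p \<Gamma>s \<tau> \<longleftrightarrow> is_mask p \<tau> \<and> \<tau> 0 = 1 \<and> accuracy_ge_one \<Gamma>s \<tau>"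

definition wavelet_mask :: "nat \<Rightarrow> (real ^ 'n \<Rightarrow> complex) \<Rightarrow> bool" where
  "wavelet_mask p t \<longleftrightarrow> is_mask p t \<and> t 0 = 0"

definition polyphase :: "nat \<Rightarrow> (int \<Rightarrow> real) \<Rightarrow> int \<Rightarrow> real \<Rightarrow> complex" where
  "polyphase p h l \<xi> =
     1 / of_nat p *
     (\<Sum>m | h (l + int p * m) \<noteq> 0. of_real (h (l + int p * m)) * cis (- (real_of_int m * \<xi>)))"


subsection \<open>Prime coset sum\<close>

definition prime_coset_sum ::
    "nat \<Rightarrow> (int ^ 'n) set \<Rightarrow> (real \<Rightarrow> complex) \<Rightarrow> real ^ 'n \<Rightarrow> complex" where
  "prime_coset_sum p \<Gamma> R \<omega> =
     1 / ((of_nat p - 1) * of_nat p ^ (CARD('n) - 1)) *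
     (1 - of_nat p ^ (CARD('n) - 1) + (\<Sum>\<nu>\<in>\<Gamma> - {0}. R (\<omega> \<bullet> rvec \<nu>)))"

definition rho :: "nat \<Rightarrow> int set \<Rightarrow> int \<Rightarrow> int" where
  "rho p F l = (THE r. r \<in> F - {0} \<and> [l * r = 1] (mod int p))"

definition eta :: "nat \<Rightarrow> int set \<Rightarrow> (int ^ 'n) set \<Rightarrow> int \<Rightarrow> int ^ 'n \<Rightarrow> int ^ 'n" where
  "eta p F \<Gamma> l \<nu> = (THE \<mu>. \<mu> \<in> \<Gamma> - {0} \<and> (\<forall>i. [\<mu> $ i = rho p F l * \<nu> $ i] (mod int p)))"


subsection \<open>Biorthogonality\<close>

definition biorthogonal ::
    "(real ^ 'n) set \<Rightarrow> (real ^ 'n \<Rightarrow> complex) \<Rightarrow> (real ^ 'n \<Rightarrow> complex) \<Rightarrow> bool" where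
  "biorthogonal \<Gamma>s \<tau> \<tau>d \<longleftrightarrow> (\<forall>\<omega>. (\<Sum>\<gamma>\<in>\<Gamma>s. cnj (\<tau> (\<omega> + \<gamma>)) * \<tau>d (\<omega> + \<gamma>)) = 1)"

definition combined_biorthogonal_masks ::
    "nat \<Rightarrow> (int ^ 'n) set \<Rightarrow> (real ^ 'n) set \<Rightarrow>
     (real ^ 'n \<Rightarrow> complex) \<Rightarrow> (int ^ 'n \<Rightarrow> real ^ 'n \<Rightarrow> complex) \<Rightarrow>
     (real ^ 'n \<Rightarrow> complex) \<Rightarrow> (int ^ 'n \<Rightarrow> real ^ 'n \<Rightarrow> complex) \<Rightarrow> bool" where
  "combined_biorthogonal_masks p \<Gamma> \<Gamma>s \<tau> t \<tau>d td \<longleftrightarrow>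
     refinement_mask p \<Gamma>s \<tau> \<and> refinement_mask p \<Gamma>s \<tau>d \<and> biorthogonal \<Gamma>s \<tau> \<tau>d \<and>
     (\<forall>\<nu>\<in>\<Gamma> - {0}. wavelet_mask p (t \<nu>) \<and> wavelet_mask p (td \<nu>)) \<and>
     (\<forall>\<omega>. \<forall>\<gamma>\<in>\<Gamma>s.
        cnj (\<tau> (\<omega> + \<gamma>)) * \<tau>d \<omega> + (\<Sum>\<nu>\<in>\<Gamma> - {0}. cnj (t \<nu> (\<omega> + \<gamma>)) * td \<nu> \<omega>)
        = (if \<gamma> = 0 then 1 else 0))"

end

theory Submission
  imports Defs "HOL-Library.Real_Mod"
begin

text \<open>
  Write \<open>N = p\<^sup>n\<close> and \<open>\<Gamma>' = \<Gamma> - {0}\<close>.  Splitting each one-dimensional mask into its polyphase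
  components turns the prime coset sum into a sum over pairs \<open>(l, \<nu>)\<close> with \<open>l \<in> F - {0}\<close> and
  \<open>\<nu> \<in> \<Gamma>'\<close>, whose terms have frequencies congruent to \<open>l\<nu>\<close> modulo \<open>p\<close>, plus a \<open>\<Gamma>\<^sup>*\<close>-periodic
  remainder.  For fixed \<open>l\<close> the map \<open>\<nu> \<mapsto> \<eta>(l,\<nu>)\<close> permutes \<open>\<Gamma>'\<close>, because \<open>l\<close> is invertible modulo
  the prime \<open>p\<close>, and \<open>l \<eta>(l,\<nu>)\<close> is congruent to \<open>\<nu>\<close>.  After this reindexing, the terms with second
  index \<open>\<nu>\<close> add up to one component \<open>v\<^sub>\<nu>\<close> (for \<open>G\<close>) or \<open>w\<^sub>\<nu>\<close> (for \<open>H\<close>) that carries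
  exactly the frequencies in the coset of \<open>\<nu>\<close>, so that a shift of the argument by \<open>\<gamma> \<in> \<Gamma>\<^sup>*\<close>
  multiplies it by \<open>exp(-i\<gamma>\<cdot>\<nu>)\<close> (\<open>component_shift\<close>, \<open>prime_coset_sum_expansion\<close>).  With the
  normalizing factor \<open>p/(p-1)\<close> built into the components, and because an interpolatory \<open>U\<close> has
  \<open>U\<^sub>0 = 1/p\<close>, which makes its remainder the constant \<open>1/N\<close>,

    \<open>C[S] = c + 1/N \<Sum>v\<^sub>\<nu>\<close>  with \<open>c\<close> periodic,    \<open>C[U] = 1/N (1 + \<Sum>w\<^sub>\<nu>)\<close>,

    \<open>t\<^sub>\<nu> = exp(-i\<omega>\<cdot>\<nu>) (1 - cnj w\<^sub>\<nu>)\<close>,    \<open>t\<^sup>d\<^sub>\<nu> = 1/N exp(-i\<omega>\<cdot>\<nu>) (1 - cnj v\<^sub>\<nu> C[U])\<close>.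

  Orthogonality of the characters of the finite group of cosets (\<open>parseval_normalized\<close>) evaluates
  the sum over \<open>\<Gamma>\<^sup>*\<close> in the definition of \<open>\<tau>\<close> as \<open>c + 1/N \<Sum>v\<^sub>\<nu> cnj w\<^sub>\<nu>\<close>.  The remainder \<open>c\<close> cancels
  and

    \<open>\<tau>(\<omega>+\<gamma>) = 1 + 1/N \<Sum>v\<^sub>\<nu>(\<omega>) (exp(-i\<gamma>\<cdot>\<nu>) - cnj w\<^sub>\<nu>(\<omega>))\<close>    (\<open>lifted_shift\<close>).

  In this form everything is a short computation.  In the combined identity
  (\<open>combined_identity\<close>) the wavelet terms containing \<open>cnj v\<^sub>\<nu>\<close> cancel against the conjugate of
  \<open>\<tau>(\<omega>+\<gamma>)\<close> times \<open>C[U]\<close>, and what is left is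
  \<open>C[U] + 1/N \<Sum>(exp(i\<gamma>\<cdot>\<nu>) - w\<^sub>\<nu>) = \<delta>\<close>.  The accuracy conditions give \<open>v\<^sub>\<nu>(0) = w\<^sub>\<nu>(0) = 1\<close>, from
  which the values of the refinement masks on \<open>\<Gamma>\<^sup>*\<close> and of the wavelet masks at \<open>0\<close> follow.  Finally, all functions
  involved are real combinations of characters, and this class is closed under products and
  conjugation; hence they are masks of real finitely supported filters.
\<close>


section \<open>Systems of coset representatives\<close>

text \<open>
  Unlike \<open>coset_reps\<close>, a transversal may omit \<open>0\<close>, so that translates of transversals are
  transversals.
\<close>

definition transversal :: "'a set \<Rightarrow> 'a set \<Rightarrow> 'a::ab_group_add set \<Rightarrow> bool" where
  "transversal L M R \<longleftrightarrow> R \<subseteq> L \<and> (\<forall>x\<in>L. \<exists>!r. r \<in> R \<and> x - r \<in> M)"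

lemma transversal_if_coset_reps: "coset_reps L M R \<Longrightarrow> transversal L M R"
  by (simp add: coset_reps_def transversal_def)

text \<open>
  Both sums run over the cosets of \<open>M\<close> in \<open>L\<close>: sending each element of \<open>R\<close> to the representative
  of its coset in \<open>Q\<close> is a bijection.
\<close>

lemma sum_transversal_cong:
  fixes f :: "'a::ab_group_add \<Rightarrow> 'b::comm_monoid_add"
  assumes M: "\<And>x y. x \<in> M \<Longrightarrow> y \<in> M \<Longrightarrow> x - y \<in> M"
    and R: "transversal L M R" and Q: "transversal L M Q"
    and f: "\<And>x y. x \<in> L \<Longrightarrow> y \<in> L \<Longrightarrow> x - y \<in> M \<Longrightarrow> f x = f y"
  shows "sum f R = sum f Q"
proof -
  define rep where "rep T x = (THE r. r \<in> T \<and> x - r \<in> M)" for T x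
  have rep: "rep T x \<in> T \<and> x - rep T x \<in> M" if "transversal L M T" "x \<in> L" for T x
  proof -
    have "\<exists>!r. r \<in> T \<and> x - r \<in> M"
      using that unfolding transversal_def by blast
    then show ?thesis
      unfolding rep_def by (rule theI')
  qed
  have rep_eq: "rep T x = r" if "transversal L M T" "x \<in> L" "r \<in> T" "x - r \<in> M" for T x r
    using rep[OF that(1,2)] that unfolding transversal_def by blast
  have sym: "y - x \<in> M" if "x - y \<in> M" for x y
    using M[OF M[OF that that] that] by simp
  have sub: "R \<subseteq> L" "Q \<subseteq> L"
    using R Q by (auto simp: transversal_def)
  show ?thesis
  proof (rule sum.reindex_bij_witness[of R "rep R" "rep Q"])
    fix r assume r: "r \<in> R"
    have *: "rep Q r \<in> Q" "r - rep Q r \<in> M"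
      using rep[OF Q, of r] r sub by auto
    show "rep R (rep Q r) = r"
      using * r sub sym by (intro rep_eq[OF R]) auto
    show "rep Q r \<in> Q" by (rule *)
    show "f (rep Q r) = f r"
      using * r sub sym by (intro f) auto
  next
    fix r assume r: "r \<in> Q"
    have *: "rep R r \<in> R" "r - rep R r \<in> M"
      using rep[OF R, of r] r sub by auto
    show "rep Q (rep R r) = r"
      using * r sub sym by (intro rep_eq[OF Q]) auto
    show "rep R r \<in> R" by (rule *)
  qed
qed

lemma card_transversal_cong:
  assumes "\<And>x y. x \<in> M \<Longrightarrow> y \<in> M \<Longrightarrow> x - y \<in> M"
    and "transversal L M R" and "transversal L M Q"
  shows "card R = card Q"
  using sum_transversal_cong[OF assms, of "\<lambda>_. 1 :: nat"] by simp

text \<open>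
  The translate of \<open>R\<close> by \<open>a\<close> is a transversal too, so summing over it leaves the sum unchanged but
  multiplies it by \<open>\<psi> a \<noteq> 1\<close>.
\<close>

lemma sum_character_transversal:
  fixes \<psi> :: "'a::ab_group_add \<Rightarrow> 'b::idom"
  assumes L: "\<And>x y. x \<in> L \<Longrightarrow> y \<in> L \<Longrightarrow> x - y \<in> L"
    and M: "\<And>x y. x \<in> M \<Longrightarrow> y \<in> M \<Longrightarrow> x - y \<in> M" and M_sub: "M \<subseteq> L"
    and R: "transversal L M R"
    and mult: "\<And>x y. x \<in> L \<Longrightarrow> y \<in> L \<Longrightarrow> \<psi> (x + y) = \<psi> x * \<psi> y"
    and triv: "\<And>x. x \<in> M \<Longrightarrow> \<psi> x = 1"
    and a: "a \<in> L" "\<psi> a \<noteq> 1"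
  shows "sum \<psi> R = 0"
proof -
  have RL: "R \<subseteq> L" and ex1: "\<And>x. x \<in> L \<Longrightarrow> \<exists>!r. r \<in> R \<and> x - r \<in> M"
    using R by (auto simp: transversal_def)
  have add: "x + y \<in> L" if "x \<in> L" "y \<in> L" for x y
    using L[OF that(1) L[OF L[OF that(2,2)] that(2)]] by simp
  have "transversal L M ((+) a ` R)"
    unfolding transversal_def
  proof (intro conjI ballI)
    show "(+) a ` R \<subseteq> L"
      using RL a add by auto
    fix x assume "x \<in> L"
    then have "\<exists>!r. r \<in> R \<and> (x - a) - r \<in> M"
      using L a by (intro ex1) auto
    then show "\<exists>!r. r \<in> (+) a ` R \<and> x - r \<in> M"
      by (auto simp: algebra_simps)
  qed
  moreover have "\<psi> x = \<psi> y" if "x \<in> L" "y \<in> L" "x - y \<in> M" for x y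
    using mult[of "x - y" y] that triv[of "x - y"] M_sub by auto
  ultimately have "sum \<psi> R = sum \<psi> ((+) a ` R)"
    using R M by (intro sum_transversal_cong[of M L])
  also have "\<dots> = (\<Sum>r\<in>R. \<psi> (a + r))"
    by (simp add: sum.reindex)
  also have "\<dots> = \<psi> a * sum \<psi> R"
    using RL a mult by (auto simp: sum_distrib_left intro!: sum.cong)
  finally show ?thesis
    using a(2) by (metis mult_cancel_right1 mult.commute)
qed


section \<open>Masks as real combinations of characters\<close>

lemma rvec_0 [simp]: "rvec 0 = 0"
  and rvec_add: "rvec (k + m) = rvec k + rvec m"
  and rvec_diff: "rvec (k - m) = rvec k - rvec m"
  and rvec_minus: "rvec (- k) = - rvec k"
  and rvec_scale: "rvec (a *s k) = of_int a *\<^sub>R rvec k"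
  by (simp_all add: rvec_def vec_eq_iff)

lemma inner_rvec_rvec: "rvec k \<bullet> rvec m = of_int (\<Sum>i\<in>UNIV. k $ i * m $ i)"
  by (simp add: rvec_def inner_vec_def)

text \<open>
  Together with the closure under addition below, this says that the masks are exactly the real
  linear combinations of the characters \<open>\<omega> \<mapsto> exp(-i k\<cdot>\<omega>)\<close>.  In that description the filter, and
  the merging of its coefficients when characters are multiplied, need not be tracked.
\<close>

lemma is_mask_monomial:
  fixes k :: "int ^ 'n"
  assumes "p > 0"
  shows "is_mask p (\<lambda>\<omega>. of_real c * cis (- (rvec k \<bullet> \<omega>)))"
proof -
  define h where "h = (\<lambda>j. if j = k then c * real p ^ CARD('n) else 0)"
  have supp: "{j. h j \<noteq> 0} = (if c = 0 then {} else {k})"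
    using assms by (auto simp: h_def)
  have "(\<lambda>\<omega>. of_real c * cis (- (rvec k \<bullet> \<omega>))) = mask_nd p h"
    using assms by (rule_tac ext) (simp add: mask_nd_def supp, simp add: h_def)
  moreover have "finite {j. h j \<noteq> 0}"
    by (simp add: supp)
  ultimately show ?thesis
    unfolding is_mask_def by blast
qed

lemma is_mask_0: "is_mask p (\<lambda>\<omega>. 0)"
  unfolding is_mask_def by (rule exI[of _ "\<lambda>_. 0"]) (auto simp: mask_nd_def)

lemma is_mask_add:
  assumes "is_mask p f" "is_mask p g"
  shows "is_mask p (\<lambda>\<omega>. f \<omega> + g \<omega>)"
proof -
  obtain h h' where h: "finite {k. h k \<noteq> 0}" "f = mask_nd p h"
    and h': "finite {k. h' k \<noteq> 0}" "g = mask_nd p h'"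
    using assms unfolding is_mask_def by blast
  let ?K = "{k. h k \<noteq> 0} \<union> {k. h' k \<noteq> 0}"
  have K: "finite ?K" using h h' by blast
  have *: "mask_nd p u \<omega> = 1 / of_nat p ^ CARD('a) * (\<Sum>k\<in>?K. of_real (u k) * cis (- (rvec k \<bullet> \<omega>)))"
    if "{k. u k \<noteq> 0} \<subseteq> ?K" for u \<omega>
    unfolding mask_nd_def using K that
    by (intro arg_cong[where f = "(*) _"] sum.mono_neutral_left) auto
  have hh': "{k. h k + h' k \<noteq> 0} \<subseteq> ?K" by auto
  have "f \<omega> + g \<omega> = mask_nd p (\<lambda>k. h k + h' k) \<omega>" for \<omega>
    unfolding h h' *[OF hh'] *[OF Un_upper1] *[OF Un_upper2]
    by (simp add: algebra_simps sum.distrib)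
  then have "(\<lambda>\<omega>. f \<omega> + g \<omega>) = mask_nd p (\<lambda>k. h k + h' k)"
    by blast
  moreover have "finite {k. h k + h' k \<noteq> 0}"
    using hh' K by (rule finite_subset)
  ultimately show ?thesis
    unfolding is_mask_def by (intro exI[of _ "\<lambda>k. h k + h' k"] conjI)
qed

lemma is_mask_sum:
  assumes "\<And>i. i \<in> I \<Longrightarrow> is_mask p (f i)"
  shows "is_mask p (\<lambda>\<omega>. \<Sum>i\<in>I. f i \<omega>)"
  using assms
  by (induction I rule: infinite_finite_induct) (auto intro: is_mask_0 is_mask_add)

lemma is_mask_expansion:
  assumes "is_mask p f"
  obtains K c where "f = (\<lambda>\<omega>. \<Sum>k\<in>K. of_real (c k) * cis (- (rvec k \<bullet> \<omega>)))"
proof -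
  obtain h where "f = mask_nd p h"
    using assms unfolding is_mask_def by blast
  then have "f = (\<lambda>\<omega>. \<Sum>k\<in>{k. h k \<noteq> 0}.
      of_real (1 / real p ^ CARD('a) * h k) * cis (- (rvec k \<bullet> \<omega>)))"
    by (auto simp: mask_nd_def sum_distrib_left intro!: ext sum.cong)
  then show ?thesis
    by (rule that)
qed

lemma is_mask_mult:
  assumes "is_mask p f" "is_mask p g" "p > 0"
  shows "is_mask p (\<lambda>\<omega>. f \<omega> * g \<omega>)"
proof -
  obtain K c where f: "f = (\<lambda>\<omega>. \<Sum>k\<in>K. of_real (c k) * cis (- (rvec k \<bullet> \<omega>)))"
    using assms is_mask_expansion by blast
  obtain J d where g: "g = (\<lambda>\<omega>. \<Sum>k\<in>J. of_real (d k) * cis (- (rvec k \<bullet> \<omega>)))"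
    using assms is_mask_expansion by blast
  have "(\<lambda>\<omega>. f \<omega> * g \<omega>) =
      (\<lambda>\<omega>. \<Sum>k\<in>K. \<Sum>j\<in>J. of_real (c k * d j) * cis (- (rvec (k + j) \<bullet> \<omega>)))"
    unfolding f g sum_product
    by (intro ext sum.cong refl) (simp add: cis_mult rvec_add inner_add_left mult_ac)
  then show ?thesis
    using is_mask_monomial[OF assms(3)] by (auto intro!: is_mask_sum simp del: of_real_mult)
qed

lemma is_mask_cnj:
  assumes "is_mask p f" "p > 0"
  shows "is_mask p (\<lambda>\<omega>. cnj (f \<omega>))"
proof -
  obtain K c where f: "f = (\<lambda>\<omega>. \<Sum>k\<in>K. of_real (c k) * cis (- (rvec k \<bullet> \<omega>)))"
    using assms is_mask_expansion by blast
  have "(\<lambda>\<omega>. cnj (f \<omega>)) = (\<lambda>\<omega>. \<Sum>k\<in>K. of_real (c k) * cis (- (rvec (- k) \<bullet> \<omega>)))"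
    unfolding f by (simp add: cis_cnj rvec_minus)
  then show ?thesis
    using is_mask_monomial[OF assms(2)] by (auto intro!: is_mask_sum)
qed

lemma is_mask_of_real: "p > 0 \<Longrightarrow> is_mask p (\<lambda>\<omega>. of_real c)"
  using is_mask_monomial[of p c 0] by simp

lemma is_mask_diff:
  assumes "is_mask p f" "is_mask p g" "p > 0"
  shows "is_mask p (\<lambda>\<omega>. f \<omega> - g \<omega>)"
  using is_mask_add[OF assms(1) is_mask_mult[OF is_mask_of_real[of p "-1"] assms(2)]] assms(3)
  by simp


section \<open>Polyphase components of a one-dimensional mask\<close>

lemma polyphase_periodic:
  "polyphase p h l (\<xi> + 2 * pi * of_int k) = polyphase p h l \<xi>"
proof -
  have "cis (- (real_of_int m * (\<xi> + 2 * pi * of_int k))) = cis (- (real_of_int m * \<xi>))" for m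
  proof -
    have "- (real_of_int m * (\<xi> + 2 * pi * of_int k)) =
        - (real_of_int m * \<xi>) + 2 * pi * of_int (- (m * k))"
      by (simp add: algebra_simps)
    then show ?thesis
      by (simp only: cis_mult[symmetric] cis_multiple_2pi[OF Ints_of_int]) simp
  qed
  then show ?thesis
    by (simp add: polyphase_def)
qed

text \<open>
  A modulated polyphase component is the part of the mask whose frequencies are congruent to \<open>l\<close>
  modulo \<open>p\<close>.
\<close>

lemma polyphase_eq_residue_sum:
  assumes "p > 0"
  shows "cis (- (of_int l * \<xi>)) * polyphase p h l (real p * \<xi>) =
    1 / of_nat p * (\<Sum>k | h k \<noteq> 0 \<and> int p dvd k - l. of_real (h k) * cis (- (of_int k * \<xi>)))"
proof -
  have "(\<Sum>m | h (l + int p * m) \<noteq> 0.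
        of_real (h (l + int p * m)) * cis (- (of_int (l + int p * m) * \<xi>))) =
      (\<Sum>k | h k \<noteq> 0 \<and> int p dvd k - l. of_real (h k) * cis (- (of_int k * \<xi>)))"
    using assms
    by (intro sum.reindex_bij_witness[of _ "\<lambda>k. (k - l) div int p" "\<lambda>m. l + int p * m"]) auto
  moreover have "cis (- (of_int (l + int p * m) * \<xi>)) =
      cis (- (of_int l * \<xi>)) * cis (- (of_int m * (real p * \<xi>)))" for m
    by (simp add: cis_mult algebra_simps)
  ultimately show ?thesis
    by (simp add: polyphase_def sum_distrib_left mult_ac) (simp flip: sum_divide_distrib)
qed

lemma sum_cis_roots_of_unity:
  assumes "p > 0"
  shows "(\<Sum>j<p. cis (of_int k * (2 * pi * real j / real p))) = (if int p dvd k then of_nat p else 0)"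
proof -
  define z where "z = cis (of_int k * (2 * pi / real p))"
  have "(\<Sum>j<p. cis (of_int k * (2 * pi * real j / real p))) = (\<Sum>j<p. z ^ j)"
    unfolding z_def Complex.DeMoivre by (intro sum.cong refl arg_cong[where f = cis]) simp
  moreover have "z = 1 \<longleftrightarrow> int p dvd k"
  proof
    assume "z = 1"
    then obtain m where "of_int k * (2 * pi / real p) = of_int m * (2 * pi)"
      unfolding z_def cis_eq_1_iff by blast
    then have "real_of_int k = of_int (int p * m)"
      using assms by (simp add: field_simps)
    then show "int p dvd k"
      by (metis dvd_triv_left of_int_eq_iff)
  next
    assume "int p dvd k"
    then obtain m where "k = int p * m" ..
    then have "of_int k * (2 * pi / real p) = 2 * pi * of_int m"
      using assms by simp
    then show "z = 1"
      unfolding z_def by simp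
  qed
  moreover have "z ^ p = 1"
  proof -
    have "real p * (of_int k * (2 * pi / real p)) = 2 * pi * of_int k"
      using assms by simp
    then show ?thesis
      unfolding z_def Complex.DeMoivre by simp
  qed
  ultimately show ?thesis
    using geometric_sum[of z p] by auto
qed

text \<open>
  A discrete Fourier transform over the shifts by \<open>2\<pi>j/p\<close> isolates one residue class of
  frequencies.  For \<open>l = 0\<close> the left side is the sum in the interpolation property.
\<close>

lemma polyphase_inversion:
  assumes "finite {k. h k \<noteq> (0::real)}" "p > 0"
  shows "(\<Sum>\<gamma>\<in>dual_1d p. cis (of_int l * \<gamma>) * mask_1d p h (\<xi> + \<gamma>)) =
    of_nat p * (cis (- (of_int l * \<xi>)) * polyphase p h l (real p * \<xi>))"
proof -
  let ?K = "{k. h k \<noteq> 0}"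
  have inj: "inj_on (\<lambda>j. 2 * pi * real j / real p) {..<p}"
    using assms(2) by (auto simp: inj_on_def)
  have "cis (of_int l * \<gamma>) * (1 / of_nat p * (of_real (h k) * cis (- (of_int k * (\<xi> + \<gamma>))))) =
      1 / of_nat p * (of_real (h k) * cis (- (of_int k * \<xi>)) * cis (of_int (l - k) * \<gamma>))" for k \<gamma>
  proof -
    have "cis (of_int l * \<gamma>) * cis (- (of_int k * (\<xi> + \<gamma>))) =
        cis (- (of_int k * \<xi>)) * cis (of_int (l - k) * \<gamma>)"
      by (simp add: cis_mult algebra_simps)
    then show ?thesis
      by (metis (no_types, opaque_lifting) mult.assoc mult.left_commute)
  qed
  then have "(\<Sum>\<gamma>\<in>dual_1d p. cis (of_int l * \<gamma>) * mask_1d p h (\<xi> + \<gamma>)) =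
      (\<Sum>j<p. \<Sum>k\<in>?K. 1 / of_nat p * (of_real (h k) * cis (- (of_int k * \<xi>))
         * cis (of_int (l - k) * (2 * pi * real j / real p))))"
    unfolding dual_1d_def sum.reindex[OF inj] mask_1d_def o_def sum_distrib_left
    by (intro sum.cong refl)
  also have "\<dots> = (\<Sum>k\<in>?K. 1 / of_nat p * (of_real (h k) * cis (- (of_int k * \<xi>))
         * (\<Sum>j<p. cis (of_int (l - k) * (2 * pi * real j / real p)))))"
    by (subst sum.swap) (simp add: sum_distrib_left)
  also have "\<dots> = (\<Sum>k\<in>?K. if int p dvd k - l then of_real (h k) * cis (- (of_int k * \<xi>)) else 0)"
    using assms(2) by (intro sum.cong refl)
      (simp only: sum_cis_roots_of_unity, simp add: dvd_diff_commute)
  also have "\<dots> = (\<Sum>k | h k \<noteq> 0 \<and> int p dvd k - l. of_real (h k) * cis (- (of_int k * \<xi>)))"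
    using assms(1) by (simp add: sum.If_cases Collect_conj_eq)
  finally show ?thesis
    using assms by (simp add: polyphase_eq_residue_sum)
qed

lemma polyphase_0_if_interpolatory:
  assumes "finite {k. h k \<noteq> (0::real)}" "p > 0" "interpolatory (dual_1d p) (mask_1d p h)"
  shows "polyphase p h 0 \<xi> = 1 / of_nat p"
proof -
  have "of_nat p * polyphase p h 0 \<xi> = (\<Sum>\<gamma>\<in>dual_1d p. mask_1d p h (\<xi> / real p + \<gamma>))"
    using polyphase_inversion[OF assms(1,2), of 0 "\<xi> / real p"] assms(2) by simp
  also have "\<dots> = 1"
    using assms(3) unfolding interpolatory_def by blast
  finally show ?thesis
    using assms(2) by (simp add: field_simps)
qed

text \<open>
  At \<open>\<xi> = 0\<close> the accuracy condition leaves only the term \<open>\<gamma> = 0\<close> in the inversion formula.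
\<close>

lemma polyphase_at_0_if_accurate:
  assumes "lowpass p h" "p > 0" "accuracy_ge_one (dual_1d p) (mask_1d p h)"
  shows "polyphase p h l 0 = 1 / of_nat p"
proof -
  have D: "finite (dual_1d p)" "0 \<in> dual_1d p"
    using assms(2) by (auto simp: dual_1d_def intro!: image_eqI[of _ _ 0])
  have "(\<Sum>\<gamma>\<in>dual_1d p. cis (of_int l * \<gamma>) * mask_1d p h (0 + \<gamma>)) = 1"
    using assms(1,3) by (subst sum.remove[OF D]) (auto simp: lowpass_def accuracy_ge_one_def)
  then show ?thesis
    using polyphase_inversion[of h p l 0] assms(1,2) by (simp add: lowpass_def field_simps)
qed

lemma mask_1d_polyphase_expansion:
  assumes "finite {k. h k \<noteq> (0::real)}" "p > 0" "reps_int p F" "finite F"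
  shows "mask_1d p h \<xi> = (\<Sum>l\<in>F. cis (- (of_int l * \<xi>)) * polyphase p h l (real p * \<xi>))"
proof -
  have ex1: "\<exists>!l. l \<in> F \<and> int p dvd k - l" for k
    using assms(3) by (auto simp: reps_int_def coset_reps_def dvd_def image_iff)
  let ?S = "\<lambda>l. {k. h k \<noteq> 0 \<and> int p dvd k - l}"
  have "{k. h k \<noteq> 0} = (\<Union>l\<in>F. ?S l)"
    using ex1 by blast
  moreover have "\<forall>l\<in>F. \<forall>m\<in>F. l \<noteq> m \<longrightarrow> ?S l \<inter> ?S m = {}"
    using ex1 by blast
  ultimately have "(\<Sum>k | h k \<noteq> 0. of_real (h k) * cis (- (of_int k * \<xi>))) =
      (\<Sum>l\<in>F. \<Sum>k\<in>?S l. of_real (h k) * cis (- (of_int k * \<xi>)))"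
    using assms(1,4) by (simp only:) (intro sum.UNION_disjoint, auto)
  then show ?thesis
    using assms by (simp add: mask_1d_def polyphase_eq_residue_sum sum_distrib_left)
qed

lemma is_mask_polyphase_inner:
  assumes "p > 0"
  shows "is_mask p (\<lambda>\<omega>. polyphase p h l (real p * (\<omega> \<bullet> rvec \<nu>)))"
proof -
  have "(\<lambda>\<omega>. polyphase p h l (real p * (\<omega> \<bullet> rvec \<nu>))) =
      (\<lambda>\<omega>. \<Sum>m | h (l + int p * m) \<noteq> 0.
         of_real (h (l + int p * m) / real p) * cis (- (rvec ((m * int p) *s \<nu>) \<bullet> \<omega>)))"
    by (simp add: polyphase_def rvec_scale inner_commute sum_distrib_left mult_ac)
  then show ?thesis
    using is_mask_monomial[OF assms] by (auto intro!: is_mask_sum simp del: of_real_divide)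
qed


section \<open>Characters of the finite groups of cosets\<close>

lemma mem_range_scale_iff: "k \<in> range (\<lambda>m. a *s m) \<longleftrightarrow> (\<forall>i. a dvd k $ i)" for k :: "int ^ 'n"
proof
  assume "\<forall>i. a dvd k $ i"
  then have "k = a *s (\<chi> i. k $ i div a)"
    by (simp add: vec_eq_iff)
  then show "k \<in> range (\<lambda>m. a *s m)"
    by blast
qed auto

lemma card_box: "card {k :: int ^ 'n. \<forall>i. k $ i \<in> {0..<int p}} = p ^ CARD('n)"
proof -
  have "{k :: int ^ 'n. \<forall>i. k $ i \<in> {0..<int p}} = vec_lambda ` (UNIV \<rightarrow>\<^sub>E {0..<int p})"
  proof (intro equalityI subsetI)
    fix k :: "int ^ 'n" assume "k \<in> {k. \<forall>i. k $ i \<in> {0..<int p}}"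
    then show "k \<in> vec_lambda ` (UNIV \<rightarrow>\<^sub>E {0..<int p})"
      by (intro image_eqI[of _ _ "vec_nth k"]) auto
  qed auto
  moreover have "inj_on vec_lambda (UNIV \<rightarrow>\<^sub>E {0..<int p} :: ('n \<Rightarrow> int) set)"
    by (auto simp: inj_on_def vec_lambda_inject)
  ultimately show ?thesis
    by (simp add: card_image card_PiE)
qed

lemma cis_dual_inner_eq_1:
  assumes "p > 0" "\<And>i. int p dvd \<nu> $ i"
  shows "cis (((2 * pi / real p) *\<^sub>R rvec k) \<bullet> rvec \<nu>) = 1"
proof -
  have "int p dvd (\<Sum>i\<in>UNIV. k $ i * \<nu> $ i)"
    using assms(2) by (intro dvd_sum) auto
  then obtain m where "(\<Sum>i\<in>UNIV. k $ i * \<nu> $ i) = int p * m" ..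
  then have "((2 * pi / real p) *\<^sub>R rvec k) \<bullet> rvec \<nu> = 2 * pi * of_int m"
    using assms(1) by (simp add: inner_rvec_rvec del: of_int_sum)
  then show ?thesis by simp
qed

lemma cis_dual_axis_eq_1_iff:
  assumes "p > 0"
  shows "cis ((2 * pi / real p) * of_int a) = 1 \<longleftrightarrow> int p dvd a"
proof
  assume "cis ((2 * pi / real p) * of_int a) = 1"
  then obtain m where "(2 * pi / real p) * of_int a = of_int m * (2 * pi)"
    unfolding cis_eq_1_iff by blast
  then have "real_of_int a = of_int (int p * m)"
    using assms by (simp add: field_simps)
  then show "int p dvd a"
    by (metis dvd_triv_left of_int_eq_iff)
next
  assume "int p dvd a"
  then obtain m where "a = int p * m" ..
  then have "(2 * pi / real p) * of_int a = 2 * pi * of_int m"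
    using assms by simp
  then show "cis ((2 * pi / real p) * of_int a) = 1"
    by (simp only: cis_multiple_2pi Ints_of_int)
qed

lemma inner_rvec_axis: "rvec k \<bullet> rvec (axis i 1) = of_int (k $ i)"
  by (simp add: inner_rvec_rvec axis_def if_distrib[of "\<lambda>x. _ * x"] cong: if_cong)

lemma inner_axis_rvec: "rvec (axis i 1) \<bullet> rvec k = of_int (k $ i)"
  by (metis inner_commute inner_rvec_axis)

text \<open>
  The parameter \<open>N\<close> abbreviates \<open>p\<^sup>n\<close>, the number of cosets on either side of the duality.
\<close>

locale coset_setting =
  fixes p :: nat and F :: "int set" and \<Gamma> :: "(int ^ 'n) set" and \<Gamma>s :: "(real ^ 'n) set"
    and N :: complex
  defines "N \<equiv> of_nat p ^ CARD('n)"
  assumes prime: "prime p" and F: "reps_int p F"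
    and \<Gamma>: "reps_lattice p \<Gamma>" and \<Gamma>s: "reps_dual p \<Gamma>s"
begin

lemma p_gt_0: "p > 0" and p_gt_1: "p > 1"
  using prime prime_gt_0_nat prime_gt_1_nat by auto

lemma zero_in_reps: "0 \<in> F" "0 \<in> \<Gamma>" "0 \<in> \<Gamma>s"
  using F \<Gamma> \<Gamma>s by (auto simp: reps_int_def reps_lattice_def reps_dual_def coset_reps_def)

lemma \<Gamma>_ex: obtains \<nu> where "\<nu> \<in> \<Gamma>" "\<And>i. int p dvd k $ i - \<nu> $ i"
proof -
  have "\<exists>\<nu>. \<nu> \<in> \<Gamma> \<and> k - \<nu> \<in> range (\<lambda>m. int p *s m)"
    using \<Gamma> unfolding reps_lattice_def coset_reps_def by blast
  then show ?thesis
    using that unfolding mem_range_scale_iff by auto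
qed

lemma \<Gamma>_unique:
  assumes "\<nu> \<in> \<Gamma>" "\<mu> \<in> \<Gamma>" "\<And>i. int p dvd \<nu> $ i - \<mu> $ i"
  shows "\<nu> = \<mu>"
proof -
  have "\<exists>!r. r \<in> \<Gamma> \<and> \<nu> - r \<in> range (\<lambda>m. int p *s m)"
    using \<Gamma> unfolding reps_lattice_def coset_reps_def by blast
  moreover have "\<nu> - \<nu> \<in> range (\<lambda>m. int p *s m)" "\<nu> - \<mu> \<in> range (\<lambda>m. int p *s m)"
    using assms(3) by (simp_all add: mem_range_scale_iff)
  ultimately show ?thesis
    using assms(1,2) by blast
qed

lemma F_ex: obtains l where "l \<in> F" "[l = k] (mod int p)"
proof -
  obtain l where "l \<in> F" "k - l \<in> range (\<lambda>m. int p * m)"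
    using F unfolding reps_int_def coset_reps_def by blast
  then show ?thesis
    using that[of l] by (auto simp: cong_iff_dvd_diff dvd_diff_commute[of _ l])
qed

lemma F_unique:
  assumes "l \<in> F" "m \<in> F" "[l = m] (mod int p)"
  shows "l = m"
proof -
  have "\<exists>!r. r \<in> F \<and> l - r \<in> range (\<lambda>m. int p * m)"
    using F unfolding reps_int_def coset_reps_def by blast
  moreover have "l - l \<in> range (\<lambda>m. int p * m)" "l - m \<in> range (\<lambda>m. int p * m)"
    using assms(3) by (auto simp: cong_iff_dvd_diff dvd_def image_iff)
  ultimately show ?thesis
    using assms(1,2) by blast
qed

lemma card_F: "card F = p"
proof -
  have "transversal UNIV (range (\<lambda>m. int p * m)) {0..<int p}"
    unfolding transversal_def
  proof (intro conjI ballI)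
    fix x :: int
    show "\<exists>!r. r \<in> {0..<int p} \<and> x - r \<in> range (\<lambda>m. int p * m)"
    proof (rule ex1I[of _ "x mod int p"])
      show "x mod int p \<in> {0..<int p} \<and> x - x mod int p \<in> range (\<lambda>m. int p * m)"
        using p_gt_0 by (simp add: minus_mod_eq_mult_div)
    next
      fix r assume "r \<in> {0..<int p} \<and> x - r \<in> range (\<lambda>m. int p * m)"
      then show "r = x mod int p"
        by (auto simp: algebra_simps)
    qed
  qed simp
  moreover have "x - y \<in> range (\<lambda>m. int p * m)"
    if "x \<in> range (\<lambda>m. int p * m)" "y \<in> range (\<lambda>m. int p * m)" for x y
    using that by (auto simp flip: right_diff_distrib)
  ultimately have "card F = card {0..<int p}"
    using F by (intro card_transversal_cong[of "range (\<lambda>m. int p * m)"])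
      (auto simp: reps_int_def transversal_if_coset_reps)
  then show ?thesis by simp
qed

text \<open>
  Compare \<open>\<Gamma>\<close> with the box \<open>{0..<p}\<^sup>n\<close>, the standard system of representatives.
\<close>

lemma card_\<Gamma>: "card \<Gamma> = p ^ CARD('n)"
proof -
  let ?B = "{k :: int ^ 'n. \<forall>i. k $ i \<in> {0..<int p}}"
  have "transversal UNIV (range (\<lambda>m. int p *s m)) ?B"
    unfolding transversal_def
  proof (intro conjI ballI)
    fix x :: "int ^ 'n"
    show "\<exists>!r. r \<in> ?B \<and> x - r \<in> range (\<lambda>m. int p *s m)"
    proof (rule ex1I[of _ "\<chi> i. x $ i mod int p"])
      show "(\<chi> i. x $ i mod int p) \<in> ?B \<and> x - (\<chi> i. x $ i mod int p) \<in> range (\<lambda>m. int p *s m)"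
        using p_gt_0 by (simp add: mem_range_scale_iff)
    next
      fix r assume "r \<in> ?B \<and> x - r \<in> range (\<lambda>m. int p *s m)"
      then have "r $ i = x $ i mod int p" for i
        unfolding mem_range_scale_iff
        by (metis (mono_tags, lifting) atLeastLessThan_iff mem_Collect_eq mod_eq_dvd_iff
            mod_pos_pos_trivial vector_minus_component)
      then show "r = (\<chi> i. x $ i mod int p)"
        by (simp add: vec_eq_iff)
    qed
  qed simp
  moreover have "x - y \<in> range (\<lambda>m. int p *s m)"
    if "x \<in> range (\<lambda>m. int p *s m)" "y \<in> range (\<lambda>m. int p *s m)" for x y :: "int ^ 'n"
    using that unfolding mem_range_scale_iff by simp
  ultimately have "card \<Gamma> = card ?B"
    using \<Gamma> by (intro card_transversal_cong[of "range (\<lambda>m. int p *s m)"])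
      (auto simp: reps_lattice_def transversal_if_coset_reps)
  then show ?thesis by (simp only: card_box)
qed

lemma finite_F: "finite F" and finite_\<Gamma>: "finite \<Gamma>"
  using card_F card_\<Gamma> p_gt_0 by (auto intro!: card_ge_0_finite)

lemma sum_split_zero:
  "(\<Sum>\<nu>\<in>\<Gamma>. f \<nu>) = f 0 + (\<Sum>\<nu>\<in>\<Gamma> - {0}. f \<nu>)" for f :: "_ \<Rightarrow> complex"
  using finite_\<Gamma> zero_in_reps by (intro sum.remove)

lemma \<Gamma>s_dual: assumes "\<gamma> \<in> \<Gamma>s" obtains k where "\<gamma> = (2 * pi / real p) *\<^sub>R rvec k"
  using assms \<Gamma>s unfolding reps_dual_def coset_reps_def by blast

lemma range_dual_diff:
  "x - y \<in> range (\<lambda>k. c *\<^sub>R rvec k)"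
  if "x \<in> range (\<lambda>k. c *\<^sub>R rvec k)" "y \<in> range (\<lambda>k. c *\<^sub>R rvec k)" for x y :: "real ^ 'n"
  using that by (auto simp flip: scaleR_right_diff_distrib rvec_diff)

lemma dual_period_iff:
  fixes k :: "int ^ 'n"
  shows "(2 * pi / real p) *\<^sub>R rvec k \<in> range (\<lambda>m. (2 * pi) *\<^sub>R rvec m) \<longleftrightarrow> (\<forall>i. int p dvd k $ i)"
proof
  assume "(2 * pi / real p) *\<^sub>R rvec k \<in> range (\<lambda>m. (2 * pi) *\<^sub>R rvec m)"
  then obtain m :: "int ^ 'n" where m: "(2 * pi / real p) *\<^sub>R rvec k = (2 * pi) *\<^sub>R rvec m"
    by blast
  show "\<forall>i. int p dvd k $ i"
  proof
    fix i
    have "(2 * pi / real p) * of_int (k $ i) = 2 * pi * of_int (m $ i)"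
      using m by (simp add: vec_eq_iff rvec_def)
    then have "real_of_int (k $ i) = of_int (int p * m $ i)"
      using p_gt_0 by (simp add: field_simps)
    then show "int p dvd k $ i"
      by (metis dvd_triv_left of_int_eq_iff)
  qed
next
  assume "\<forall>i. int p dvd k $ i"
  then obtain m where "k = int p *s m"
    unfolding mem_range_scale_iff[symmetric] by blast
  then have "(2 * pi / real p) *\<^sub>R rvec k = (2 * pi) *\<^sub>R rvec m"
    using p_gt_0 by (simp add: rvec_scale)
  then show "(2 * pi / real p) *\<^sub>R rvec k \<in> range (\<lambda>m. (2 * pi) *\<^sub>R rvec m)"
    by blast
qed

text \<open>
  Scaling by \<open>2\<pi>/p\<close> carries \<open>\<Gamma>\<close> to another system of representatives of the dual cosets.
\<close>

lemma card_\<Gamma>s: "card \<Gamma>s = p ^ CARD('n)"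
proof -
  let ?d = "\<lambda>k :: int ^ 'n. (2 * pi / real p) *\<^sub>R rvec k"
  let ?M = "range (\<lambda>k :: int ^ 'n. (2 * pi) *\<^sub>R rvec k)"
  have d_diff: "?d x - ?d y = ?d (x - y)" for x y
    by (simp add: rvec_diff scaleR_right_diff_distrib)
  have "transversal (range ?d) ?M (?d ` \<Gamma>)"
    unfolding transversal_def
  proof (intro conjI ballI)
    fix x assume "x \<in> range ?d"
    then obtain k where k: "x = ?d k" by blast
    obtain \<nu> where \<nu>: "\<nu> \<in> \<Gamma>" "\<And>i. int p dvd k $ i - \<nu> $ i"
      using \<Gamma>_ex by blast
    show "\<exists>!r. r \<in> ?d ` \<Gamma> \<and> x - r \<in> ?M"
    proof (rule ex1I[of _ "?d \<nu>"])
      show "?d \<nu> \<in> ?d ` \<Gamma> \<and> x - ?d \<nu> \<in> ?M"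
        using \<nu> imageI[OF \<nu>(1), of ?d] unfolding k d_diff dual_period_iff by simp
    next
      fix r assume r: "r \<in> ?d ` \<Gamma> \<and> x - r \<in> ?M"
      then obtain \<mu> where \<mu>: "\<mu> \<in> \<Gamma>" "r = ?d \<mu>" by blast
      have k\<mu>: "int p dvd k $ i - \<mu> $ i" for i
        using r unfolding k \<mu> d_diff dual_period_iff by simp
      have "int p dvd \<mu> $ i - \<nu> $ i" for i
        using dvd_diff[OF \<nu>(2)[of i] k\<mu>[of i]] by simp
      then show "r = ?d \<nu>"
        using \<Gamma>_unique[OF \<mu>(1) \<nu>(1)] \<mu>(2) by blast
    qed
  qed blast
  moreover have "transversal (range ?d) ?M \<Gamma>s"
    using \<Gamma>s by (simp add: reps_dual_def transversal_if_coset_reps)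
  ultimately have "card \<Gamma>s = card (?d ` \<Gamma>)"
    by (intro card_transversal_cong[of ?M] range_dual_diff)
  moreover have "inj ?d"
    using p_gt_0 by (auto simp: inj_def rvec_def vec_eq_iff)
  ultimately show ?thesis
    by (simp add: card_image inj_on_subset card_\<Gamma>)
qed

text \<open>
  For \<open>\<gamma> \<noteq> 0\<close> some coordinate of \<open>p\<gamma>/2\<pi>\<close> is not divisible by \<open>p\<close>, and the character of \<open>\<gamma>\<close> is
  nontrivial at the corresponding unit vector.
\<close>

lemma sum_dual_character:
  assumes \<gamma>: "\<gamma> \<in> \<Gamma>s"
  shows "(\<Sum>\<nu>\<in>\<Gamma>. cis (\<gamma> \<bullet> rvec \<nu>)) = (if \<gamma> = 0 then N else 0)"
proof (cases "\<gamma> = 0")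
  case False
  obtain k where k: "\<gamma> = (2 * pi / real p) *\<^sub>R rvec k"
    using \<Gamma>s_dual \<gamma> by blast
  have "\<gamma> \<notin> range (\<lambda>m. (2 * pi) *\<^sub>R rvec m)"
  proof
    assume "\<gamma> \<in> range (\<lambda>m. (2 * pi) *\<^sub>R rvec m)"
    then have "\<gamma> - 0 \<in> range (\<lambda>m. (2 * pi) *\<^sub>R rvec m)"
      by simp
    moreover have "\<gamma> - \<gamma> \<in> range (\<lambda>m. (2 * pi) *\<^sub>R rvec m)"
      by (auto intro!: image_eqI[of _ _ 0])
    moreover have "\<exists>!r. r \<in> \<Gamma>s \<and> \<gamma> - r \<in> range (\<lambda>m. (2 * pi) *\<^sub>R rvec m)"
      using \<Gamma>s k unfolding reps_dual_def coset_reps_def by blast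
    ultimately show False
      using \<gamma> zero_in_reps(3) False by blast
  qed
  then obtain i where i: "\<not> int p dvd k $ i"
    unfolding k dual_period_iff by blast
  have "(\<Sum>\<nu>\<in>\<Gamma>. cis (\<gamma> \<bullet> rvec \<nu>)) = 0"
  proof (rule sum_character_transversal)
    show "transversal UNIV (range (\<lambda>m. int p *s m)) \<Gamma>"
      using \<Gamma> by (simp add: reps_lattice_def transversal_if_coset_reps)
    show "cis (\<gamma> \<bullet> rvec (axis i 1)) \<noteq> 1"
      using i cis_dual_axis_eq_1_iff[OF p_gt_0, of "k $ i"] unfolding k
      by (simp add: inner_rvec_axis)
    show "cis (\<gamma> \<bullet> rvec x) = 1" if "x \<in> range (\<lambda>m. int p *s m)" for x
      using that unfolding k mem_range_scale_iff
      by (intro cis_dual_inner_eq_1 p_gt_0) blast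
    show "x - y \<in> range (\<lambda>m. int p *s m)"
      if "x \<in> range (\<lambda>m. int p *s m)" "y \<in> range (\<lambda>m. int p *s m)" for x y :: "int ^ 'n"
      using that unfolding mem_range_scale_iff by simp
  qed (simp_all add: rvec_add inner_add_right flip: cis_mult)
  then show ?thesis using False by simp
qed (simp add: card_\<Gamma> N_def)

lemma sum_lattice_character:
  "(\<Sum>\<gamma>\<in>\<Gamma>s. cis (\<gamma> \<bullet> rvec \<nu>)) = (if \<forall>i. int p dvd \<nu> $ i then N else 0)"
proof (cases "\<forall>i. int p dvd \<nu> $ i")
  case True
  have "cis (\<gamma> \<bullet> rvec \<nu>) = 1" if "\<gamma> \<in> \<Gamma>s" for \<gamma>
    using \<Gamma>s_dual[OF that] True cis_dual_inner_eq_1[OF p_gt_0] by metis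
  then show ?thesis
    using True by (simp add: card_\<Gamma>s N_def)
next
  case False
  then obtain i where i: "\<not> int p dvd \<nu> $ i" by blast
  let ?d = "\<lambda>k :: int ^ 'n. (2 * pi / real p) *\<^sub>R rvec k"
  have "(\<Sum>\<gamma>\<in>\<Gamma>s. cis (\<gamma> \<bullet> rvec \<nu>)) = 0"
  proof (rule sum_character_transversal)
    show "transversal (range ?d) (range (\<lambda>k. (2 * pi) *\<^sub>R rvec k)) \<Gamma>s"
      using \<Gamma>s by (simp add: reps_dual_def transversal_if_coset_reps)
    show "?d (axis i 1) \<in> range ?d" by blast
    show "cis (?d (axis i 1) \<bullet> rvec \<nu>) \<noteq> 1"
      using i cis_dual_axis_eq_1_iff[OF p_gt_0, of "\<nu> $ i"] by (simp add: inner_axis_rvec)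
    show "cis (x \<bullet> rvec \<nu>) = 1" if "x \<in> range (\<lambda>k. (2 * pi) *\<^sub>R rvec k)" for x
      using that by (auto simp: inner_rvec_rvec simp del: of_int_sum)
    show "range (\<lambda>k. (2 * pi) *\<^sub>R rvec k) \<subseteq> range ?d"
    proof safe
      fix m :: "int ^ 'n"
      have "(2 * pi) *\<^sub>R rvec m = ?d (int p *s m)"
        using p_gt_0 by (simp add: rvec_scale)
      then show "(2 * pi) *\<^sub>R rvec m \<in> range ?d" by blast
    qed
  qed (use range_dual_diff in \<open>simp_all add: inner_add_left flip: cis_mult\<close>)
  then show ?thesis by (simp only: False if_False)
qed

text \<open>
  On \<open>\<Gamma>\<^sup>*\<close> the exponentials with frequencies in \<open>\<Gamma>\<close> are orthogonal, since distinct elements of \<open>\<Gamma>\<close>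
  differ by a vector outside \<open>p\<int>\<^sup>n\<close>.
\<close>

lemma parseval:
  fixes a b :: "int ^ 'n \<Rightarrow> complex"
  shows "(\<Sum>\<gamma>\<in>\<Gamma>s. (\<Sum>\<nu>\<in>\<Gamma>. a \<nu> * cis (\<gamma> \<bullet> rvec \<nu>)) * (\<Sum>\<nu>\<in>\<Gamma>. b \<nu> * cis (- (\<gamma> \<bullet> rvec \<nu>)))) =
    N * (\<Sum>\<nu>\<in>\<Gamma>. a \<nu> * b \<nu>)"
proof -
  have "(\<Sum>\<gamma>\<in>\<Gamma>s. (\<Sum>\<nu>\<in>\<Gamma>. a \<nu> * cis (\<gamma> \<bullet> rvec \<nu>)) * (\<Sum>\<mu>\<in>\<Gamma>. b \<mu> * cis (- (\<gamma> \<bullet> rvec \<mu>)))) =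
      (\<Sum>\<gamma>\<in>\<Gamma>s. \<Sum>\<nu>\<in>\<Gamma>. \<Sum>\<mu>\<in>\<Gamma>. a \<nu> * b \<mu> * cis (\<gamma> \<bullet> rvec (\<nu> - \<mu>)))"
    unfolding sum_product
    by (intro sum.cong refl) (simp add: rvec_diff inner_diff_right cis_mult mult_ac)
  also have "\<dots> = (\<Sum>\<nu>\<in>\<Gamma>. \<Sum>\<mu>\<in>\<Gamma>. a \<nu> * b \<mu> * (\<Sum>\<gamma>\<in>\<Gamma>s. cis (\<gamma> \<bullet> rvec (\<nu> - \<mu>))))"
    by (subst sum.swap, intro sum.cong refl, subst sum.swap) (simp add: sum_distrib_left)
  also have "\<dots> = (\<Sum>\<nu>\<in>\<Gamma>. \<Sum>\<mu>\<in>\<Gamma>. if \<nu> = \<mu> then a \<nu> * b \<mu> * N else 0)"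
  proof (intro sum.cong refl)
    fix \<nu> \<mu> assume "\<nu> \<in> \<Gamma>" "\<mu> \<in> \<Gamma>"
    then have "(\<forall>i. int p dvd (\<nu> - \<mu>) $ i) \<longleftrightarrow> \<nu> = \<mu>"
      using \<Gamma>_unique[of \<nu> \<mu>] by auto
    then show "a \<nu> * b \<mu> * (\<Sum>\<gamma>\<in>\<Gamma>s. cis (\<gamma> \<bullet> rvec (\<nu> - \<mu>))) =
        (if \<nu> = \<mu> then a \<nu> * b \<mu> * N else 0)"
      unfolding sum_lattice_character by auto
  qed
  also have "\<dots> = N * (\<Sum>\<nu>\<in>\<Gamma>. a \<nu> * b \<nu>)"
    using finite_\<Gamma> by (simp add: sum_distrib_left mult_ac)
  finally show ?thesis .
qed

lemma cis_dual_cong: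
  assumes "\<gamma> \<in> \<Gamma>s" "\<And>i. int p dvd \<nu> $ i - \<mu> $ i"
  shows "cis (\<gamma> \<bullet> rvec \<nu>) = cis (\<gamma> \<bullet> rvec \<mu>)"
proof -
  obtain k where "\<gamma> = (2 * pi / real p) *\<^sub>R rvec k"
    using \<Gamma>s_dual assms(1) by blast
  then have "cis (\<gamma> \<bullet> rvec (\<nu> - \<mu>)) = 1"
    using cis_dual_inner_eq_1[OF p_gt_0, of "\<nu> - \<mu>" k] assms(2) by simp
  moreover have "cis (\<gamma> \<bullet> rvec \<nu>) = cis (\<gamma> \<bullet> rvec (\<nu> - \<mu>)) * cis (\<gamma> \<bullet> rvec \<mu>)"
    by (simp add: cis_mult rvec_diff inner_diff_right)
  ultimately show ?thesis by simp
qed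


section \<open>The reindexing \<open>\<eta>\<close>\<close>

text \<open>
  This is where \<open>p\<close> has to be prime: every nonzero residue class is then invertible.
\<close>

lemma rho_inverse:
  assumes "l \<in> F - {0}"
  shows "[l * rho p F l = 1] (mod int p)"
proof -
  have "\<not> int p dvd l"
    using F_unique[of l 0] assms zero_in_reps by (auto simp: cong_iff_dvd_diff)
  then have cop: "coprime l (int p)"
    using prime by (metis coprime_commute prime_imp_coprime prime_nat_int_transfer)
  then obtain x where x: "[l * x = 1] (mod int p)"
    using cong_solve_coprime_int by blast
  obtain r where r: "r \<in> F" "[r = x] (mod int p)"
    using F_ex by blast
  have lr: "[l * r = 1] (mod int p)"
    using cong_trans[OF cong_scalar_left[OF r(2)] x] .
  moreover have "r \<noteq> 0"
    using lr p_gt_1 by (auto simp: cong_def)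
  moreover have "r' = r" if "r' \<in> F" "[l * r' = 1] (mod int p)" for r'
    using F_unique[OF that(1) r(1)] cong_mult_lcancel[OF cop] cong_trans[OF that(2) cong_sym[OF lr]]
    by blast
  ultimately have "\<exists>!r. r \<in> F - {0} \<and> [l * r = 1] (mod int p)"
    using r(1) by blast
  from theI'[OF this] show ?thesis
    unfolding rho_def by blast
qed

text \<open>
  Multiplication by \<open>l\<close> undoes multiplication by \<open>\<rho>(l)\<close> modulo \<open>p\<close>; in particular the class of
  \<open>\<rho>(l)\<nu>\<close> is nonzero, so that it has a representative in \<open>\<Gamma> - {0}\<close>.
\<close>

lemma eta_mem_cong:
  assumes l: "l \<in> F - {0}" and \<nu>: "\<nu> \<in> \<Gamma> - {0}"
  shows "eta p F \<Gamma> l \<nu> \<in> \<Gamma> - {0}" "int p dvd (l *s eta p F \<Gamma> l \<nu>) $ i - \<nu> $ i"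
proof -
  obtain \<mu> where \<mu>: "\<mu> \<in> \<Gamma>" "\<And>i. [\<mu> $ i = rho p F l * \<nu> $ i] (mod int p)"
    using \<Gamma>_ex[of "rho p F l *s \<nu>"]
    by (auto simp: cong_iff_dvd_diff dvd_diff_commute)
  have l\<mu>: "[l * \<mu> $ i = \<nu> $ i] (mod int p)" for i
  proof -
    have "[l * \<mu> $ i = l * (rho p F l * \<nu> $ i)] (mod int p)"
      by (rule cong_scalar_left[OF \<mu>(2)])
    moreover have "[l * rho p F l * \<nu> $ i = 1 * \<nu> $ i] (mod int p)"
      by (rule cong_scalar_right[OF rho_inverse[OF l]])
    ultimately show ?thesis
      using cong_trans by (fastforce simp: mult.assoc)
  qed
  have "\<mu> \<noteq> 0"
  proof
    assume "\<mu> = 0"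
    then have "int p dvd 0 - \<nu> $ i" for i
      using l\<mu>[of i] by (simp add: cong_iff_dvd_diff)
    then show False
      using \<Gamma>_unique[of 0 \<nu>] \<nu> zero_in_reps by auto
  qed
  moreover have "\<mu>' = \<mu>" if "\<mu>' \<in> \<Gamma>" "\<forall>i. [\<mu>' $ i = rho p F l * \<nu> $ i] (mod int p)" for \<mu>'
    using \<Gamma>_unique[OF that(1) \<mu>(1)] that(2) \<mu>(2)
    by (meson cong_iff_dvd_diff cong_sym cong_trans)
  ultimately have "eta p F \<Gamma> l \<nu> = \<mu>"
    unfolding eta_def using \<mu> by (intro the_equality) blast+
  then show "eta p F \<Gamma> l \<nu> \<in> \<Gamma> - {0}" "int p dvd (l *s eta p F \<Gamma> l \<nu>) $ i - \<nu> $ i"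
    using \<mu>(1) \<open>\<mu> \<noteq> 0\<close> l\<mu>[of i] by (auto simp: cong_iff_dvd_diff)
qed

text \<open>
  The vector \<open>\<eta>(l,\<nu>)\<close> determines \<open>\<nu>\<close> modulo \<open>p\<close>, and an injective self-map of a finite set is
  onto.
\<close>

lemma bij_betw_eta:
  assumes l: "l \<in> F - {0}"
  shows "bij_betw (eta p F \<Gamma> l) (\<Gamma> - {0}) (\<Gamma> - {0})"
proof -
  have "inj_on (eta p F \<Gamma> l) (\<Gamma> - {0})"
  proof (rule inj_onI)
    fix \<nu> \<mu> assume *: "\<nu> \<in> \<Gamma> - {0}" "\<mu> \<in> \<Gamma> - {0}" "eta p F \<Gamma> l \<nu> = eta p F \<Gamma> l \<mu>"
    have "int p dvd \<nu> $ i - \<mu> $ i" for i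
      using dvd_diff[OF eta_mem_cong(2)[OF l *(2), of i] eta_mem_cong(2)[OF l *(1), of i]] *(3)
      by simp
    then show "\<nu> = \<mu>"
      using \<Gamma>_unique[of \<nu> \<mu>] * by blast
  qed
  moreover have "eta p F \<Gamma> l ` (\<Gamma> - {0}) \<subseteq> \<Gamma> - {0}"
    by (intro image_subsetI eta_mem_cong(1)[OF l])
  ultimately show ?thesis
    unfolding bij_betw_def using endo_inj_surj[of "\<Gamma> - {0}"] finite_\<Gamma> by simp
qed


section \<open>Coset components of a prime coset sum\<close>

text \<open>
  Up to the factor \<open>N\<close>, this is the part of \<open>C[R]\<close> (with \<open>R\<close> the mask of \<open>h\<close>) whose frequencies
  lie in the coset of \<open>\<nu>\<close>.  The factor \<open>p/(p-1)\<close> makes its value at \<open>0\<close> equal to \<open>1\<close> for accurate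
  masks, and it is the factor that appears in the wavelet masks.
\<close>

definition component :: "(int \<Rightarrow> real) \<Rightarrow> int ^ 'n \<Rightarrow> real ^ 'n \<Rightarrow> complex" where
  "component h \<nu> \<omega> = of_nat p / (of_nat p - 1) *
     (\<Sum>l\<in>F - {0}. cis (- ((\<omega> \<bullet> rvec (eta p F \<Gamma> l \<nu>)) * of_int l)) *
        polyphase p h l (real p * (\<omega> \<bullet> rvec (eta p F \<Gamma> l \<nu>))))"

text \<open>
  The part of \<open>C[R]\<close> with frequencies in \<open>p\<int>\<^sup>n\<close>.
\<close>

definition offset :: "(int \<Rightarrow> real) \<Rightarrow> real ^ 'n \<Rightarrow> complex" where
  "offset h \<omega> = 1 / ((of_nat p - 1) * of_nat p ^ (CARD('n) - 1)) *
     (1 - of_nat p ^ (CARD('n) - 1) + (\<Sum>\<nu>\<in>\<Gamma> - {0}. polyphase p h 0 (real p * (\<omega> \<bullet> rvec \<nu>))))"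

lemma p_nonzero: "of_nat p \<noteq> (0 :: complex)" "of_nat p - 1 \<noteq> (0 :: complex)"
  using p_gt_1 by auto

lemma N_nonzero: "N \<noteq> 0"
  using p_nonzero by (simp add: N_def)

lemma N_Suc: "N = of_nat p * of_nat p ^ (CARD('n) - 1)"
  by (simp add: N_def flip: power_Suc)

lemma polyphase_shift:
  assumes "\<gamma> \<in> \<Gamma>s"
  shows "polyphase p h l (real p * ((\<omega> + \<gamma>) \<bullet> rvec \<nu>)) = polyphase p h l (real p * (\<omega> \<bullet> rvec \<nu>))"
proof -
  obtain k where "\<gamma> = (2 * pi / real p) *\<^sub>R rvec k"
    using \<Gamma>s_dual assms by blast
  then have "real p * ((\<omega> + \<gamma>) \<bullet> rvec \<nu>) =
      real p * (\<omega> \<bullet> rvec \<nu>) + 2 * pi * of_int (\<Sum>i\<in>UNIV. k $ i * \<nu> $ i)"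
    using p_gt_0 by (simp add: inner_add_left inner_rvec_rvec distrib_left del: of_int_sum)
  then show ?thesis
    by (simp only: polyphase_periodic)
qed

text \<open>
  The polyphase factors are unaffected by the shift, and the exponentials have frequency
  \<open>l \<eta>(l,\<nu>)\<close>, which is congruent to \<open>\<nu>\<close> modulo \<open>p\<close>, for every \<open>l\<close>.
\<close>

lemma component_shift:
  assumes \<gamma>: "\<gamma> \<in> \<Gamma>s" and \<nu>: "\<nu> \<in> \<Gamma> - {0}"
  shows "component h \<nu> (\<omega> + \<gamma>) = cis (- (\<gamma> \<bullet> rvec \<nu>)) * component h \<nu> \<omega>"
proof -
  have "cis (- (((\<omega> + \<gamma>) \<bullet> rvec (eta p F \<Gamma> l \<nu>)) * of_int l)) =
      cis (- (\<gamma> \<bullet> rvec \<nu>)) * cis (- ((\<omega> \<bullet> rvec (eta p F \<Gamma> l \<nu>)) * of_int l))"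
    if l: "l \<in> F - {0}" for l
  proof -
    have "cis (\<gamma> \<bullet> rvec (l *s eta p F \<Gamma> l \<nu>)) = cis (\<gamma> \<bullet> rvec \<nu>)"
      by (rule cis_dual_cong[OF \<gamma> eta_mem_cong(2)[OF l \<nu>]])
    then have "cnj (cis (\<gamma> \<bullet> rvec (l *s eta p F \<Gamma> l \<nu>))) = cnj (cis (\<gamma> \<bullet> rvec \<nu>))"
      by simp
    then have "cis (- (\<gamma> \<bullet> rvec \<nu>)) = cis (- (of_int l * (\<gamma> \<bullet> rvec (eta p F \<Gamma> l \<nu>))))"
      by (simp add: cis_cnj rvec_scale)
    then show ?thesis
      by (simp add: cis_mult inner_add_left algebra_simps)
  qed
  then show ?thesis
    by (simp add: component_def polyphase_shift[OF \<gamma>] sum_distrib_left mult_ac)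
qed

lemma offset_shift: "\<gamma> \<in> \<Gamma>s \<Longrightarrow> offset h (\<omega> + \<gamma>) = offset h \<omega>"
  by (simp add: offset_def polyphase_shift)

text \<open>
  The term \<open>l = 0\<close> of the polyphase expansions goes into the offset.  The others form a double sum
  over \<open>l\<close> and \<open>\<nu>\<close>, in which \<open>\<nu>\<close> is replaced by \<open>\<eta>(l,\<nu>)\<close> for each fixed \<open>l\<close>.
\<close>

lemma prime_coset_sum_expansion:
  assumes "finite {k. h k \<noteq> 0}"
  shows "prime_coset_sum p \<Gamma> (mask_1d p h) \<omega> = offset h \<omega> + 1 / N * (\<Sum>\<nu>\<in>\<Gamma> - {0}. component h \<nu> \<omega>)"
proof -
  let ?P = "\<lambda>l \<mu>. cis (- ((\<omega> \<bullet> rvec \<mu>) * of_int l)) * polyphase p h l (real p * (\<omega> \<bullet> rvec \<mu>))"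
  have "mask_1d p h (\<omega> \<bullet> rvec \<nu>) =
      polyphase p h 0 (real p * (\<omega> \<bullet> rvec \<nu>)) + (\<Sum>l\<in>F - {0}. ?P l \<nu>)" for \<nu>
    using finite_F zero_in_reps
    by (simp add: mask_1d_polyphase_expansion[OF assms p_gt_0 F] sum.remove[of F 0] mult_ac)
  then have "(\<Sum>\<nu>\<in>\<Gamma> - {0}. mask_1d p h (\<omega> \<bullet> rvec \<nu>)) =
      (\<Sum>\<nu>\<in>\<Gamma> - {0}. polyphase p h 0 (real p * (\<omega> \<bullet> rvec \<nu>))) +
      (\<Sum>\<nu>\<in>\<Gamma> - {0}. \<Sum>l\<in>F - {0}. ?P l \<nu>)"
    by (simp add: sum.distrib)
  also have "(\<Sum>\<nu>\<in>\<Gamma> - {0}. \<Sum>l\<in>F - {0}. ?P l \<nu>) = (\<Sum>l\<in>F - {0}. \<Sum>\<nu>\<in>\<Gamma> - {0}. ?P l \<nu>)"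
    by (rule sum.swap)
  also have "\<dots> = (\<Sum>l\<in>F - {0}. \<Sum>\<nu>\<in>\<Gamma> - {0}. ?P l (eta p F \<Gamma> l \<nu>))"
    by (intro sum.cong refl sum.reindex_bij_betw[symmetric] bij_betw_eta)
  also have "\<dots> = (\<Sum>\<nu>\<in>\<Gamma> - {0}. \<Sum>l\<in>F - {0}. ?P l (eta p F \<Gamma> l \<nu>))"
    by (rule sum.swap)
  also have "\<dots> = (\<Sum>\<nu>\<in>\<Gamma> - {0}. (of_nat p - 1) / of_nat p * component h \<nu> \<omega>)"
    using p_nonzero by (simp add: component_def)
  also have "\<dots> = (of_nat p - 1) / of_nat p * (\<Sum>\<nu>\<in>\<Gamma> - {0}. component h \<nu> \<omega>)"
    by (simp add: sum_distrib_left)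
  finally have sum_eq: "(\<Sum>\<nu>\<in>\<Gamma> - {0}. mask_1d p h (\<omega> \<bullet> rvec \<nu>)) =
      (\<Sum>\<nu>\<in>\<Gamma> - {0}. polyphase p h 0 (real p * (\<omega> \<bullet> rvec \<nu>))) +
      (of_nat p - 1) / of_nat p * (\<Sum>\<nu>\<in>\<Gamma> - {0}. component h \<nu> \<omega>)" .
  have "1 / ((of_nat p - 1) * of_nat p ^ (CARD('n) - 1)) * ((of_nat p - 1) / of_nat p) = 1 / N"
    using p_nonzero by (simp add: N_Suc)
  then show ?thesis
    unfolding prime_coset_sum_def offset_def sum_eq
    by (simp only: distrib_left mult.assoc[symmetric] add.assoc)
qed

lemma offset_eq:
  assumes "\<And>\<xi>. polyphase p h 0 \<xi> = 1 / of_nat p"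
  shows "offset h \<omega> = 1 / N"
proof -
  have "of_nat (card (\<Gamma> - {0})) = N - 1"
    using zero_in_reps finite_\<Gamma> p_gt_0 by (simp add: card_Diff_singleton card_\<Gamma> N_def of_nat_diff)
  then have "offset h \<omega> = 1 / ((of_nat p - 1) * of_nat p ^ (CARD('n) - 1)) *
      (1 - of_nat p ^ (CARD('n) - 1) + (N - 1) / of_nat p)"
    by (simp add: offset_def assms)
  also have "1 - of_nat p ^ (CARD('n) - 1) + (N - 1) / of_nat p = (of_nat p - 1) / of_nat p"
    using p_nonzero by (simp add: N_Suc field_simps)
  finally show ?thesis
    using p_nonzero by (simp add: N_Suc)
qed

lemma component_at_0:
  assumes "\<And>l. polyphase p h l 0 = 1 / of_nat p"
  shows "component h \<nu> 0 = 1"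
proof -
  have "of_nat (card (F - {0})) = (of_nat p - 1 :: complex)"
    using zero_in_reps finite_F p_gt_0 by (simp add: card_Diff_singleton card_F of_nat_diff)
  then show ?thesis
    using p_nonzero by (simp add: component_def assms)
qed

lemma is_mask_component: "is_mask p (component h \<nu>)"
proof -
  \<comment> \<open>Masks have real coefficients, so the factor has to be exhibited as a real number.\<close>
  have p_real: "of_nat p / (of_nat p - 1) = complex_of_real (real p / (real p - 1))"
    by simp
  have mono: "is_mask p (\<lambda>\<omega>. cis (- ((\<omega> \<bullet> rvec \<mu>) * of_int l)))" for \<mu> :: "int ^ 'n" and l
    using is_mask_monomial[OF p_gt_0, of 1 "l *s \<mu>"] by (simp add: rvec_scale inner_commute mult_ac)
  have "is_mask p (\<lambda>\<omega>. complex_of_real (real p / (real p - 1)) *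
     (\<Sum>l\<in>F - {0}. cis (- ((\<omega> \<bullet> rvec (eta p F \<Gamma> l \<nu>)) * of_int l)) *
        polyphase p h l (real p * (\<omega> \<bullet> rvec (eta p F \<Gamma> l \<nu>)))))"
    by (intro is_mask_mult is_mask_sum is_mask_of_real is_mask_polyphase_inner mono p_gt_0)
  then show ?thesis
    unfolding component_def[abs_def] p_real .
qed

lemma sum_nonzero_character:
  assumes "\<gamma> \<in> \<Gamma>s"
  shows "(\<Sum>\<nu>\<in>\<Gamma> - {0}. cis (\<gamma> \<bullet> rvec \<nu>)) = (if \<gamma> = 0 then N else 0) - 1"
  unfolding sum_dual_character[OF assms, symmetric] sum_split_zero by simp

text \<open>
  Parseval's identity for coefficients \<open>N a\<close> and \<open>1\<close> at frequency \<open>0\<close>, scaled in the way in which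
  prime coset sums present themselves.
\<close>

lemma parseval_normalized:
  "(\<Sum>\<gamma>\<in>\<Gamma>s. (a + 1 / N * (\<Sum>\<nu>\<in>\<Gamma> - {0}. x \<nu> * cis (- (\<gamma> \<bullet> rvec \<nu>)))) *
     (1 / N * (1 + (\<Sum>\<nu>\<in>\<Gamma> - {0}. y \<nu> * cis (\<gamma> \<bullet> rvec \<nu>))))) =
   a + 1 / N * (\<Sum>\<nu>\<in>\<Gamma> - {0}. x \<nu> * y \<nu>)"
proof -
  let ?x = "\<lambda>\<nu>. if \<nu> = 0 then N * a else x \<nu>" and ?y = "\<lambda>\<nu>. if \<nu> = 0 then 1 else y \<nu>"
  have "(\<Sum>\<nu>\<in>\<Gamma>. ?x \<nu> * cis (- (\<gamma> \<bullet> rvec \<nu>))) =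
      N * (a + 1 / N * (\<Sum>\<nu>\<in>\<Gamma> - {0}. x \<nu> * cis (- (\<gamma> \<bullet> rvec \<nu>))))" for \<gamma>
    using N_nonzero by (simp add: sum_split_zero distrib_left)
  moreover have "(\<Sum>\<nu>\<in>\<Gamma>. ?y \<nu> * cis (\<gamma> \<bullet> rvec \<nu>)) =
      1 + (\<Sum>\<nu>\<in>\<Gamma> - {0}. y \<nu> * cis (\<gamma> \<bullet> rvec \<nu>))" for \<gamma>
    by (simp add: sum_split_zero)
  moreover have "(\<Sum>\<nu>\<in>\<Gamma>. ?y \<nu> * ?x \<nu>) = N * (a + 1 / N * (\<Sum>\<nu>\<in>\<Gamma> - {0}. x \<nu> * y \<nu>))"
    using N_nonzero by (simp add: sum_split_zero distrib_left mult_ac)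
  ultimately have "(\<Sum>\<gamma>\<in>\<Gamma>s. (1 + (\<Sum>\<nu>\<in>\<Gamma> - {0}. y \<nu> * cis (\<gamma> \<bullet> rvec \<nu>))) *
      (N * (a + 1 / N * (\<Sum>\<nu>\<in>\<Gamma> - {0}. x \<nu> * cis (- (\<gamma> \<bullet> rvec \<nu>)))))) =
      N * (N * (a + 1 / N * (\<Sum>\<nu>\<in>\<Gamma> - {0}. x \<nu> * y \<nu>)))"
    using parseval[of ?y ?x] by presburger
  then have "(1 / N * (1 / N)) * (\<Sum>\<gamma>\<in>\<Gamma>s. (1 + (\<Sum>\<nu>\<in>\<Gamma> - {0}. y \<nu> * cis (\<gamma> \<bullet> rvec \<nu>))) *
      (N * (a + 1 / N * (\<Sum>\<nu>\<in>\<Gamma> - {0}. x \<nu> * cis (- (\<gamma> \<bullet> rvec \<nu>)))))) =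
      a + 1 / N * (\<Sum>\<nu>\<in>\<Gamma> - {0}. x \<nu> * y \<nu>)"
    using N_nonzero by simp
  moreover have "(1 / N * (1 / N)) * (B * (N * A)) = A * (1 / N * B)" for A B
    using N_nonzero by simp
  ultimately show ?thesis
    by (simp only: sum_distrib_left)
qed

end


section \<open>The lifted masks\<close>

locale prime_coset_lifting = coset_setting p F \<Gamma> \<Gamma>s N
  for p F and \<Gamma> :: "(int ^ 'n) set" and \<Gamma>s N +
  fixes G H :: "int \<Rightarrow> real"
  assumes G: "lowpass p G" "accuracy_ge_one (dual_1d p) (mask_1d p G)"
    and H: "lowpass p H" "accuracy_ge_one (dual_1d p) (mask_1d p H)"
      "interpolatory (dual_1d p) (mask_1d p H)"
begin

abbreviation CG :: "real ^ 'n \<Rightarrow> complex" where "CG \<equiv> prime_coset_sum p \<Gamma> (mask_1d p G)"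
abbreviation CH :: "real ^ 'n \<Rightarrow> complex" where "CH \<equiv> prime_coset_sum p \<Gamma> (mask_1d p H)"
abbreviation v where "v \<equiv> component G"
abbreviation w where "w \<equiv> component H"

definition lifted :: "real ^ 'n \<Rightarrow> complex" where
  "lifted \<omega> = CG \<omega> + (1 - (\<Sum>\<gamma>\<in>\<Gamma>s. CG (\<omega> + \<gamma>) * cnj (CH (\<omega> + \<gamma>))))"

lemma v_0: "v \<nu> 0 = 1" and w_0: "w \<nu> 0 = 1"
  using component_at_0 polyphase_at_0_if_accurate[OF _ p_gt_0] G H by blast+

lemma CG_shift:
  assumes "\<gamma> \<in> \<Gamma>s"
  shows "CG (\<omega> + \<gamma>) = offset G \<omega> + 1 / N * (\<Sum>\<nu>\<in>\<Gamma> - {0}. v \<nu> \<omega> * cis (- (\<gamma> \<bullet> rvec \<nu>)))"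
proof -
  have "CG (\<omega> + \<gamma>) = offset G (\<omega> + \<gamma>) + 1 / N * (\<Sum>\<nu>\<in>\<Gamma> - {0}. v \<nu> (\<omega> + \<gamma>))"
    using G(1) by (intro prime_coset_sum_expansion) (simp add: lowpass_def)
  then show ?thesis
    using assms by (simp add: offset_shift component_shift mult_ac)
qed

lemma CH_shift:
  assumes "\<gamma> \<in> \<Gamma>s"
  shows "CH (\<omega> + \<gamma>) = 1 / N * (1 + (\<Sum>\<nu>\<in>\<Gamma> - {0}. w \<nu> \<omega> * cis (- (\<gamma> \<bullet> rvec \<nu>))))"
proof -
  have fin: "finite {k. H k \<noteq> 0}"
    using H(1) by (simp add: lowpass_def)
  have "CH (\<omega> + \<gamma>) = offset H (\<omega> + \<gamma>) + 1 / N * (\<Sum>\<nu>\<in>\<Gamma> - {0}. w \<nu> (\<omega> + \<gamma>))"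
    by (rule prime_coset_sum_expansion[OF fin])
  also have "offset H (\<omega> + \<gamma>) = 1 / N"
    by (intro offset_eq polyphase_0_if_interpolatory fin p_gt_0 H(3))
  finally show ?thesis
    using assms by (simp add: component_shift mult_ac distrib_left)
qed

lemma CH_eq: "CH \<omega> = 1 / N * (1 + (\<Sum>\<nu>\<in>\<Gamma> - {0}. w \<nu> \<omega>))"
  using CH_shift[OF zero_in_reps(3), of \<omega>] by simp

lemma cnj_N: "cnj N = N"
  by (simp add: N_def)

text \<open>
  Conjugate form, in which the mask of \<open>H\<close> enters the sums over \<open>\<Gamma>\<^sup>*\<close>.
\<close>

lemma cnj_CH_shift:
  assumes "\<gamma> \<in> \<Gamma>s"
  shows "cnj (CH (\<omega> + \<gamma>)) = 1 / N * (1 + (\<Sum>\<nu>\<in>\<Gamma> - {0}. cnj (w \<nu> \<omega>) * cis (\<gamma> \<bullet> rvec \<nu>)))"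
  by (simp add: CH_shift[OF assms] cnj_N cis_cnj)

text \<open>
  By Parseval's identity the correlation of the two coset sums contains the offset of \<open>G\<close>, which
  therefore cancels.  The result involves no shifts, so it also shows that \<open>\<tau>\<close> is a mask.
\<close>

lemma lifted_eq: "lifted \<omega> = 1 + 1 / N * (\<Sum>\<nu>\<in>\<Gamma> - {0}. v \<nu> \<omega> * (1 - cnj (w \<nu> \<omega>)))"
proof -
  have "(\<Sum>\<gamma>\<in>\<Gamma>s. CG (\<omega> + \<gamma>) * cnj (CH (\<omega> + \<gamma>))) =
      offset G \<omega> + 1 / N * (\<Sum>\<nu>\<in>\<Gamma> - {0}. v \<nu> \<omega> * cnj (w \<nu> \<omega>))"
    by (rule trans[OF _ parseval_normalized], intro sum.cong refl) (simp only: CG_shift cnj_CH_shift)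
  moreover have "CG \<omega> = offset G \<omega> + 1 / N * (\<Sum>\<nu>\<in>\<Gamma> - {0}. v \<nu> \<omega>)"
    using CG_shift[OF zero_in_reps(3), of \<omega>] by simp
  ultimately show ?thesis
    by (simp add: lifted_def sum_subtractf right_diff_distrib)
qed

lemma lifted_shift:
  assumes "\<gamma> \<in> \<Gamma>s"
  shows "lifted (\<omega> + \<gamma>) =
    1 + 1 / N * (\<Sum>\<nu>\<in>\<Gamma> - {0}. v \<nu> \<omega> * (cis (- (\<gamma> \<bullet> rvec \<nu>)) - cnj (w \<nu> \<omega>)))"
proof -
  have "v \<nu> (\<omega> + \<gamma>) * (1 - cnj (w \<nu> (\<omega> + \<gamma>))) =
      v \<nu> \<omega> * (cis (- (\<gamma> \<bullet> rvec \<nu>)) - cnj (w \<nu> \<omega>))" if "\<nu> \<in> \<Gamma> - {0}" for \<nu>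
  proof -
    have "cis (- (\<gamma> \<bullet> rvec \<nu>)) * cis (\<gamma> \<bullet> rvec \<nu>) = 1"
      by (simp add: cis_mult)
    moreover have "e * c = 1 \<Longrightarrow> (e * a) * (1 - c * b) = a * (e - b)" for e c a b :: complex
      by (simp add: algebra_simps)
    ultimately show ?thesis
      by (simp add: component_shift[OF assms that] cis_cnj)
  qed
  then show ?thesis
    unfolding lifted_eq by simp
qed

lemma cnj_lifted_shift:
  assumes "\<gamma> \<in> \<Gamma>s"
  shows "cnj (lifted (\<omega> + \<gamma>)) =
    1 + 1 / N * (\<Sum>\<nu>\<in>\<Gamma> - {0}. cnj (v \<nu> \<omega>) * (cis (\<gamma> \<bullet> rvec \<nu>) - w \<nu> \<omega>))"
  by (simp add: lifted_shift[OF assms] cnj_N cis_cnj)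

text \<open>
  In its dependence on \<open>\<gamma>\<close>, the shifted mask has the same coefficients \<open>v\<^sub>\<nu>\<close> at nonzero frequencies
  as the coset sum of \<open>G\<close>, while its constant term is adjusted to make the correlation \<open>1\<close>.
\<close>

lemma biorthogonal_lifted: "biorthogonal \<Gamma>s lifted CH"
  unfolding biorthogonal_def
proof
  fix \<omega>
  let ?K = "\<Sum>\<nu>\<in>\<Gamma> - {0}. v \<nu> \<omega> * cnj (w \<nu> \<omega>)"
  have *: "lifted (\<omega> + \<gamma>) = (1 - 1 / N * ?K) + 1 / N * (\<Sum>\<nu>\<in>\<Gamma> - {0}. v \<nu> \<omega> * cis (- (\<gamma> \<bullet> rvec \<nu>)))"
    if "\<gamma> \<in> \<Gamma>s" for \<gamma>
    by (simp add: lifted_shift[OF that] right_diff_distrib sum_subtractf)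
  have "(\<Sum>\<gamma>\<in>\<Gamma>s. lifted (\<omega> + \<gamma>) * cnj (CH (\<omega> + \<gamma>))) = (1 - 1 / N * ?K) + 1 / N * ?K"
    by (rule trans[OF _ parseval_normalized], intro sum.cong refl) (simp only: * cnj_CH_shift)
  then have "cnj (\<Sum>\<gamma>\<in>\<Gamma>s. lifted (\<omega> + \<gamma>) * cnj (CH (\<omega> + \<gamma>))) = 1"
    by simp
  then show "(\<Sum>\<gamma>\<in>\<Gamma>s. cnj (lifted (\<omega> + \<gamma>)) * CH (\<omega> + \<gamma>)) = 1"
    by simp
qed

lemma of_real_N_inverse: "1 / N = of_real (1 / real p ^ CARD('n))"
  by (simp add: N_def)

lemma refinement_mask_CH: "refinement_mask p \<Gamma>s CH"
  unfolding refinement_mask_def accuracy_ge_one_def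
proof (intro conjI ballI)
  have "is_mask p (\<lambda>\<omega>. of_real (1 / real p ^ CARD('n)) * (of_real 1 + (\<Sum>\<nu>\<in>\<Gamma> - {0}. w \<nu> \<omega>)))"
    by (intro is_mask_mult is_mask_add is_mask_sum is_mask_of_real is_mask_component p_gt_0)
  moreover have "CH = (\<lambda>\<omega>. of_real (1 / real p ^ CARD('n)) * (of_real 1 + (\<Sum>\<nu>\<in>\<Gamma> - {0}. w \<nu> \<omega>)))"
    by (rule ext) (simp only: CH_eq of_real_N_inverse of_real_1)
  ultimately show "is_mask p CH" by simp
  have CH_dual: "CH \<gamma> = (if \<gamma> = 0 then 1 else 0)" if "\<gamma> \<in> \<Gamma>s" for \<gamma>
  proof -
    have "cnj (CH (0 + \<gamma>)) = (if \<gamma> = 0 then 1 else 0)"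
      unfolding cnj_CH_shift[OF that] w_0 using N_nonzero sum_nonzero_character[OF that] by simp
    then show ?thesis
      by (simp split: if_splits)
  qed
  show "CH 0 = 1"
    using CH_dual zero_in_reps by simp
  show "CH \<gamma> = 0" if "\<gamma> \<in> \<Gamma>s - {0}" for \<gamma>
    using CH_dual that by simp
qed

lemma refinement_mask_lifted: "refinement_mask p \<Gamma>s lifted"
  unfolding refinement_mask_def accuracy_ge_one_def
proof (intro conjI ballI)
  have "is_mask p (\<lambda>\<omega>. of_real 1 + of_real (1 / real p ^ CARD('n)) *
      (\<Sum>\<nu>\<in>\<Gamma> - {0}. v \<nu> \<omega> * (of_real 1 - cnj (w \<nu> \<omega>))))"
    by (intro is_mask_mult is_mask_add is_mask_diff is_mask_cnj is_mask_sum is_mask_of_real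
        is_mask_component p_gt_0)
  moreover have "lifted = (\<lambda>\<omega>. of_real 1 + of_real (1 / real p ^ CARD('n)) *
      (\<Sum>\<nu>\<in>\<Gamma> - {0}. v \<nu> \<omega> * (of_real 1 - cnj (w \<nu> \<omega>))))"
    by (rule ext) (simp only: lifted_eq of_real_N_inverse of_real_1)
  ultimately show "is_mask p lifted" by simp
  show "lifted 0 = 1"
    by (simp add: lifted_eq w_0)
  show "lifted \<gamma> = 0" if "\<gamma> \<in> \<Gamma>s - {0}" for \<gamma>
  proof -
    have \<gamma>: "\<gamma> \<in> \<Gamma>s" using that by blast
    have "(\<Sum>\<nu>\<in>\<Gamma> - {0}. cnj (v \<nu> 0) * (cis (\<gamma> \<bullet> rvec \<nu>) - w \<nu> 0)) =
        (\<Sum>\<nu>\<in>\<Gamma> - {0}. cis (\<gamma> \<bullet> rvec \<nu>)) - (\<Sum>\<nu>\<in>\<Gamma> - {0}. cis (0 \<bullet> rvec \<nu>))"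
      by (simp add: v_0 w_0 sum_subtractf)
    also have "\<dots> = - N"
      unfolding sum_nonzero_character[OF \<gamma>] sum_nonzero_character[OF zero_in_reps(3)]
      using that by simp
    finally have "cnj (lifted (0 + \<gamma>)) = 0"
      unfolding cnj_lifted_shift[OF \<gamma>] using N_nonzero by simp
    then show ?thesis by simp
  qed
qed

definition wavelet :: "int ^ 'n \<Rightarrow> real ^ 'n \<Rightarrow> complex" where
  "wavelet \<nu> \<omega> = cis (- (\<omega> \<bullet> rvec \<nu>)) * (1 - cnj (w \<nu> \<omega>))"

definition dual_wavelet :: "int ^ 'n \<Rightarrow> real ^ 'n \<Rightarrow> complex" where
  "dual_wavelet \<nu> \<omega> = 1 / N * cis (- (\<omega> \<bullet> rvec \<nu>)) * (1 - cnj (v \<nu> \<omega>) * CH \<omega>)"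

lemma is_mask_modulation: "is_mask p (\<lambda>\<omega>. cis (- (\<omega> \<bullet> rvec \<nu>)))"
  using is_mask_monomial[OF p_gt_0, of 1 \<nu>] by (simp add: inner_commute)

lemma wavelet_mask_wavelet: "wavelet_mask p (wavelet \<nu>)"
proof -
  have "is_mask p (\<lambda>\<omega>. cis (- (\<omega> \<bullet> rvec \<nu>)) * (of_real 1 - cnj (w \<nu> \<omega>)))"
    by (intro is_mask_mult is_mask_modulation is_mask_diff is_mask_cnj is_mask_of_real
        is_mask_component p_gt_0)
  then show ?thesis
    by (simp add: wavelet_mask_def wavelet_def[abs_def] w_0)
qed

lemma wavelet_mask_dual_wavelet: "wavelet_mask p (dual_wavelet \<nu>)"
proof -
  have CH: "is_mask p CH" "CH 0 = 1"
    using refinement_mask_CH by (auto simp: refinement_mask_def)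
  have "is_mask p (\<lambda>\<omega>. of_real (1 / real p ^ CARD('n)) * cis (- (\<omega> \<bullet> rvec \<nu>)) *
      (of_real 1 - cnj (v \<nu> \<omega>) * CH \<omega>))"
    by (intro is_mask_mult is_mask_modulation is_mask_diff is_mask_cnj is_mask_of_real
        is_mask_component p_gt_0 CH)
  then have "is_mask p (dual_wavelet \<nu>)"
    unfolding dual_wavelet_def[abs_def] of_real_N_inverse of_real_1 .
  then show ?thesis
    by (simp add: wavelet_mask_def dual_wavelet_def v_0 CH)
qed

text \<open>
  The wavelet products split into a part without \<open>v\<^sub>\<nu>\<close> and a part that is \<open>C[U]\<close> times the negative of
  the sum in \<open>cnj_lifted_shift\<close>.  The second part cancels; in the first, \<open>\<Sum>w\<^sub>\<nu> = N C[U] - 1\<close>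
  removes the remaining \<open>C[U]\<close> and the character sum produces the Kronecker delta.
\<close>

lemma combined_identity:
  assumes \<gamma>: "\<gamma> \<in> \<Gamma>s"
  shows "cnj (lifted (\<omega> + \<gamma>)) * CH \<omega> +
      (\<Sum>\<nu>\<in>\<Gamma> - {0}. cnj (wavelet \<nu> (\<omega> + \<gamma>)) * dual_wavelet \<nu> \<omega>) = (if \<gamma> = 0 then 1 else 0)"
proof -
  let ?e = "\<lambda>\<nu>. cis (\<gamma> \<bullet> rvec \<nu>)"
  let ?A = "\<Sum>\<nu>\<in>\<Gamma> - {0}. cnj (v \<nu> \<omega>) * (?e \<nu> - w \<nu> \<omega>)"
  have "cnj (wavelet \<nu> (\<omega> + \<gamma>)) * dual_wavelet \<nu> \<omega> =
      1 / N * (?e \<nu> - w \<nu> \<omega>) - 1 / N * CH \<omega> * (cnj (v \<nu> \<omega>) * (?e \<nu> - w \<nu> \<omega>))"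
    if \<nu>: "\<nu> \<in> \<Gamma> - {0}" for \<nu>
  proof -
    have "cnj (wavelet \<nu> (\<omega> + \<gamma>)) =
        cis ((\<omega> + \<gamma>) \<bullet> rvec \<nu>) - cis ((\<omega> + \<gamma>) \<bullet> rvec \<nu>) * cis (- (\<gamma> \<bullet> rvec \<nu>)) * w \<nu> \<omega>"
      by (simp add: wavelet_def component_shift[OF \<gamma> \<nu>] cis_cnj right_diff_distrib)
    also have "\<dots> = cis (\<omega> \<bullet> rvec \<nu>) * (?e \<nu> - w \<nu> \<omega>)"
      by (simp add: cis_mult inner_add_left right_diff_distrib)
    finally have "cnj (wavelet \<nu> (\<omega> + \<gamma>)) * dual_wavelet \<nu> \<omega> =
        (cis (\<omega> \<bullet> rvec \<nu>) * cis (- (\<omega> \<bullet> rvec \<nu>))) *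
        (1 / N * (?e \<nu> - w \<nu> \<omega>) * (1 - cnj (v \<nu> \<omega>) * CH \<omega>))"
      by (simp add: dual_wavelet_def)
    also have "cis (\<omega> \<bullet> rvec \<nu>) * cis (- (\<omega> \<bullet> rvec \<nu>)) = 1"
      by (simp add: cis_mult)
    finally show ?thesis
      by (simp add: algebra_simps)
  qed
  then have "(\<Sum>\<nu>\<in>\<Gamma> - {0}. cnj (wavelet \<nu> (\<omega> + \<gamma>)) * dual_wavelet \<nu> \<omega>) =
      1 / N * ((\<Sum>\<nu>\<in>\<Gamma> - {0}. ?e \<nu>) - (\<Sum>\<nu>\<in>\<Gamma> - {0}. w \<nu> \<omega>)) - 1 / N * CH \<omega> * ?A"
    by (simp only: sum_subtractf sum_distrib_left right_diff_distrib cong: sum.cong)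
  also have "(\<Sum>\<nu>\<in>\<Gamma> - {0}. w \<nu> \<omega>) = N * CH \<omega> - 1"
    using N_nonzero by (simp add: CH_eq)
  also have "(\<Sum>\<nu>\<in>\<Gamma> - {0}. ?e \<nu>) = (if \<gamma> = 0 then N else 0) - 1"
    by (rule sum_nonzero_character[OF \<gamma>])
  finally show ?thesis
    unfolding cnj_lifted_shift[OF \<gamma>] using N_nonzero by (simp add: algebra_simps)
qed

lemma combined_biorthogonal_masks_lifted:
  "combined_biorthogonal_masks p \<Gamma> \<Gamma>s lifted wavelet CH dual_wavelet"
  unfolding combined_biorthogonal_masks_def
  using refinement_mask_lifted refinement_mask_CH biorthogonal_lifted
    wavelet_mask_wavelet wavelet_mask_dual_wavelet combined_identity
  by blast

end


section \<open>Combined biorthogonality of the given masks\<close>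

lemma combined_biorthogonal_masks_cong:
  assumes "combined_biorthogonal_masks p \<Gamma> \<Gamma>s \<tau> t \<tau>d td"
    and "\<And>\<nu>. \<nu> \<in> \<Gamma> - {0} \<Longrightarrow> t \<nu> = t' \<nu>" "\<And>\<nu>. \<nu> \<in> \<Gamma> - {0} \<Longrightarrow> td \<nu> = td' \<nu>"
  shows "combined_biorthogonal_masks p \<Gamma> \<Gamma>s \<tau> t' \<tau>d td'"
proof -
  have "(\<Sum>\<nu>\<in>\<Gamma> - {0}. cnj (t \<nu> (\<omega> + \<gamma>)) * td \<nu> \<omega>) =
      (\<Sum>\<nu>\<in>\<Gamma> - {0}. cnj (t' \<nu> (\<omega> + \<gamma>)) * td' \<nu> \<omega>)" for \<omega> \<gamma>
    using assms(2,3) by (intro sum.cong) auto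
  moreover have "(\<forall>\<nu>\<in>\<Gamma> - {0}. wavelet_mask p (t \<nu>) \<and> wavelet_mask p (td \<nu>)) \<longleftrightarrow>
      (\<forall>\<nu>\<in>\<Gamma> - {0}. wavelet_mask p (t' \<nu>) \<and> wavelet_mask p (td' \<nu>))"
    using assms(2,3) by (intro ball_cong) auto
  ultimately show ?thesis
    using assms(1) unfolding combined_biorthogonal_masks_def by presburger
qed

theorem theorem1:
  fixes p :: nat
    and G H :: "int \<Rightarrow> real"
    and F :: "int set"
    and \<Gamma> :: "(int ^ 'n) set"
    and \<Gamma>s :: "(real ^ 'n) set"
    and S U :: "real \<Rightarrow> complex"
    and \<tau> \<tau>d :: "real ^ 'n \<Rightarrow> complex"
    and t td :: "int ^ 'n \<Rightarrow> real ^ 'n \<Rightarrow> complex"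
  assumes "prime p"
    and "reps_int p F"
    and "reps_lattice p \<Gamma>"
    and "reps_dual p \<Gamma>s"
    and "lowpass p G"
    and "lowpass p H"
    and "S = mask_1d p G"
    and "U = mask_1d p H"
    and "accuracy_ge_one (dual_1d p) S"
    and "accuracy_ge_one (dual_1d p) U"
    and "interpolatory (dual_1d p) U"
    and "\<And>\<omega>. \<tau> \<omega> = prime_coset_sum p \<Gamma> S \<omega> +
           (1 - (\<Sum>\<gamma>\<in>\<Gamma>s. prime_coset_sum p \<Gamma> S (\<omega> + \<gamma>) * cnj (prime_coset_sum p \<Gamma> U (\<omega> + \<gamma>))))"
    and "\<And>\<omega>. \<tau>d \<omega> = prime_coset_sum p \<Gamma> U \<omega>"
    and "\<And>\<nu> \<omega>. \<nu> \<in> \<Gamma> - {0} \<Longrightarrow>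
           t \<nu> \<omega> = cis (- (\<omega> \<bullet> rvec \<nu>)) *
             (1 - of_nat p / (of_nat p - 1) *
               (\<Sum>l\<in>F - {0}. cis ((\<omega> \<bullet> rvec (eta p F \<Gamma> l \<nu>)) * real_of_int l) *
                  cnj (polyphase p H l (real p * (\<omega> \<bullet> rvec (eta p F \<Gamma> l \<nu>))))))"
    and "\<And>\<nu> \<omega>. \<nu> \<in> \<Gamma> - {0} \<Longrightarrow>
           td \<nu> \<omega> = 1 / of_nat p ^ CARD('n) * cis (- (\<omega> \<bullet> rvec \<nu>)) *
             (1 - of_nat p / (of_nat p - 1) *
               (\<Sum>l\<in>F - {0}. cis ((\<omega> \<bullet> rvec (eta p F \<Gamma> l \<nu>)) * real_of_int l) *
                  cnj (polyphase p G l (real p * (\<omega> \<bullet> rvec (eta p F \<Gamma> l \<nu>)))) * \<tau>d \<omega>))"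
  shows "combined_biorthogonal_masks p \<Gamma> \<Gamma>s \<tau> t \<tau>d td"
proof -
  interpret prime_coset_lifting p F \<Gamma> \<Gamma>s "of_nat p ^ CARD('n)" G H
    using assms(1-11) by unfold_locales simp_all
  have \<tau>: "\<tau> = lifted"
    unfolding lifted_def[abs_def] assms(7,8)[symmetric] using assms(12) by blast
  have \<tau>d: "\<tau>d = prime_coset_sum p \<Gamma> (mask_1d p H)"
    using assms(8,13) by blast
  \<comment> \<open>Conjugating a component reverses its exponentials but not the factor \<open>p/(p-1)\<close>.\<close>
  have cnj_component: "cnj (component h \<nu> \<omega>) = of_nat p / (of_nat p - 1) *
      (\<Sum>l\<in>F - {0}. cis ((\<omega> \<bullet> rvec (eta p F \<Gamma> l \<nu>)) * of_int l) *
         cnj (polyphase p h l (real p * (\<omega> \<bullet> rvec (eta p F \<Gamma> l \<nu>)))))" for h \<nu> \<omega>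
    by (simp add: component_def cis_cnj)
  have "wavelet \<nu> = t \<nu>" if "\<nu> \<in> \<Gamma> - {0}" for \<nu>
    by (rule ext) (simp only: assms(14)[OF that] wavelet_def cnj_component)
  moreover have "dual_wavelet \<nu> = td \<nu>" if "\<nu> \<in> \<Gamma> - {0}" for \<nu>
    by (rule ext) (simp only: assms(15)[OF that] dual_wavelet_def cnj_component \<tau>d
        sum_distrib_right mult.assoc)
  ultimately show ?thesis
    unfolding \<tau> \<tau>d by (rule combined_biorthogonal_masks_cong[OF combined_biorthogonal_masks_lifted])
qed

end
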